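(* Let $r,n,m\ge 1$ be integers and let $P$ be an $r$-partite $r$-pattern. \begin{enumerate} \item In general, \[\mathrm{ex}_<(n, P^{(m)}) \ge \binom{n}{r}-\binom{(n-r(m-1))_+}{r}.\] \item If $n$ is sufficiently large in terms of $r$, then \[\mathrm{ex}_<(n, P^{(m)})\le O\left(r^2(m-1)\binom{n}{r-1}\right),\] where the implicit constant is absolute. \item If $P$ is the alternating $r$-pattern represented by $|\mathrm{AB}|\mathrm{BA}|\mathrm{AB}|\mathrm{BA}|\cdots|$ (with $r$ blocks), then \[\mathrm{ex}_<(n, P^{(m)}) = \binom{n}{r}-\binom{(n-r(m-1))_+}{r}.\] \end{enumerate}
   Context: $(x)_+=\max(x,0)$. An ordered $r$-graph is an $r$-uniform hypergraph with a total order on its vertex set. An (ordered) $r$-matching is an ordered $r$-graph in which every vertex is contained in exactly one edge; its size is its number of edges. An $r$-matching is $r$-partite if, when the vertex set is divided into $r$ contiguous intervals of equal length, every edge has exactly one vertex in each interval. An $r$-pattern is an $r$-matching of size $2$ on the vertex set $\{1,\dots,2r\}$; it is represented by a string of letters A and B (starting with A) of length $2r$, whose $i$-th letter tells which of the two edges contains vertex $i$. (Vertical bars in the representation only mark blocks and have no other meaning.) Thus in the alternating $r$-pattern, positions $2i-1,2i$ carry the letters AB if $i$ is odd and BA if $i$ is even, for $1\le i\le r$. An $r$-matching is a $P$-clique if every pair of its edges (with the induced ordering on their $2r$ vertices) is order-isomorphic to $P$. For $r$-partite $P$, there is exactly one $P$-clique of size $m$ on the vertex set $\{1,\dots,rm\}$,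 denoted $P^{(m)}$ (so $P^{(2)}=P$, and $P^{(1)}$ is a single edge). An ordered $r$-graph $G$ is $F$-free if it contains no (not necessarily induced) subgraph isomorphic to $F$ via an order-preserving isomorphism. $\mathrm{ex}_<(n,F)$ is the maximum number of edges in an $F$-free $n$-vertex ordered $r$-graph. *)

theory Defs
  imports Complex_Main
begin

text \<open>The total order on the vertices is the one of the vertex type.\<close>

record 'a ograph =
  verts :: "'a set"
  edges :: "'a set set"

definition ordered_rgraph :: "nat \<Rightarrow> 'a::linorder ograph \<Rightarrow> bool" where
  "ordered_rgraph r G \<longleftrightarrow>
     finite (verts G) \<and> (\<forall>e\<in>edges G. e \<subseteq> verts G \<and> card e = r)"

definition order_isomorphic :: "'a::linorder ograph \<Rightarrow> 'b::linorder ograph \<Rightarrow> bool" where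
  "order_isomorphic G H \<longleftrightarrow>
     (\<exists>f. bij_betw f (verts G) (verts H) \<and> strict_mono_on (verts G) f \<and>
          edges H = (\<lambda>e. f ` e) ` edges G)"

definition subgraph :: "'a::linorder ograph \<Rightarrow> 'a ograph \<Rightarrow> bool" where
  "subgraph H G \<longleftrightarrow>
     verts H \<subseteq> verts G \<and> edges H \<subseteq> edges G \<and> (\<forall>e\<in>edges H. e \<subseteq> verts H)"

definition is_free :: "'b::linorder ograph \<Rightarrow> 'a::linorder ograph \<Rightarrow> bool" where
  "is_free F G \<longleftrightarrow> \<not> (\<exists>H. subgraph H G \<and> order_isomorphic H F)"

text \<open>Every finite totally ordered set is order-isomorphic to a set of natural numbers, so
  it suffices to let \<open>G\<close> range over graphs with vertices in \<^typ>\<open>nat\<close>. The set below is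
  bounded by \<open>n choose r\<close>, and it is nonempty whenever \<open>F\<close> has an edge.\<close>

definition ex_less :: "nat \<Rightarrow> nat \<Rightarrow> 'b::linorder ograph \<Rightarrow> nat" where
  "ex_less r n F =
     Max {card (edges G) | G :: nat ograph.
            ordered_rgraph r G \<and> card (verts G) = n \<and> is_free F G}"

definition r_matching :: "nat \<Rightarrow> 'a::linorder ograph \<Rightarrow> bool" where
  "r_matching r M \<longleftrightarrow>
     ordered_rgraph r M \<and> (\<forall>v\<in>verts M. \<exists>!e. e \<in> edges M \<and> v \<in> e)"

text \<open>The \<open>i\<close>-th (\<open>i < r\<close>) of the \<open>r\<close> contiguous intervals of equal length into which \<open>V\<close>
  is divided, selected by the rank of a vertex in \<open>V\<close>. In an \<open>r\<close>-matching, \<open>r\<close> divides \<open>card V\<close>.\<close>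

definition interval_part :: "nat \<Rightarrow> 'a::linorder set \<Rightarrow> nat \<Rightarrow> 'a set" where
  "interval_part r V i =
     {v \<in> V. i * (card V div r) \<le> card {u \<in> V. u < v} \<and>
             card {u \<in> V. u < v} < (i + 1) * (card V div r)}"

definition r_partite :: "nat \<Rightarrow> 'a::linorder ograph \<Rightarrow> bool" where
  "r_partite r M \<longleftrightarrow>
     r_matching r M \<and> (\<forall>e\<in>edges M. \<forall>i<r. card (e \<inter> interval_part r (verts M) i) = 1)"

definition r_pattern :: "nat \<Rightarrow> nat ograph \<Rightarrow> bool" where
  "r_pattern r P \<longleftrightarrow> r_matching r P \<and> card (edges P) = 2 \<and> verts P = {1..2 * r}"

definition is_clique :: "nat \<Rightarrow> nat ograph \<Rightarrow> 'a::linorder ograph \<Rightarrow> bool" where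
  "is_clique r P M \<longleftrightarrow>
     r_matching r M \<and>
     (\<forall>e\<in>edges M. \<forall>f\<in>edges M. e \<noteq> f \<longrightarrow>
        order_isomorphic \<lparr>verts = e \<union> f, edges = {e, f}\<rparr> P)"

text \<open>The graph \<open>P\<^sup>(\<^sup>m\<^sup>)\<close>; for an \<open>r\<close>-partite \<open>r\<close>-pattern \<open>P\<close> and \<open>m \<ge> 1\<close> the description is
  uniquely satisfied.\<close>

definition clique_graph :: "nat \<Rightarrow> nat ograph \<Rightarrow> nat \<Rightarrow> nat ograph" where
  "clique_graph r P m =
     (THE M. verts M = {1..r * m} \<and> is_clique r P M \<and> card (edges M) = m)"

datatype letter = A | B

text \<open>The \<open>i\<close>-th letter (counted from 1) tells which of the two edges contains vertex \<open>i\<close>.\<close>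

definition pattern_of_word :: "letter list \<Rightarrow> nat ograph" where
  "pattern_of_word w =
     \<lparr>verts = {1..length w},
      edges = {{i \<in> {1..length w}. w ! (i - 1) = A}, {i \<in> {1..length w}. w ! (i - 1) = B}}\<rparr>"

definition alternating_pattern :: "nat \<Rightarrow> nat ograph" where
  "alternating_pattern r =
     pattern_of_word (concat (map (\<lambda>i. if odd i then [A, B] else [B, A]) [1..<r + 1]))"

end

theory Submission
  imports Defs "HOL-Library.FuncSet"
begin

text \<open>
  An \<open>r\<close>-partite pattern is a sequence of signs: of its two edges, the one that comes first in
  block \<open>0\<close> comes first in block \<open>i\<close> if and only if \<open>s i\<close> holds. Accordingly, the clique on
  \<open>m\<close> edges places its \<open>j\<close>-th edge at place \<open>j\<close> or \<open>m - 1 - j\<close> of block \<open>i\<close>, and its vertices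
  have ranks that depend on nothing else (\<open>rank_in_pattern_clique\<close>). This
  identifies \<open>P\<^sup>(\<^sup>m\<^sup>)\<close> and turns the extremal number into the maximal size of a family of
  \<open>r\<close>-subsets of \<open>{1..n}\<close> among which no \<open>m\<close> sets pairwise follow the signs.

  Lower bound. The last edge of a clique leaves, in every block, \<open>m - 1\<close> vertices on a
  prescribed side of its own vertex. Deleting this room, \<open>r * (m - 1)\<close> vertices in all,
  compresses the edge to an \<open>r\<close>-subset of \<open>{1..n - r * (m - 1)}\<close>. The \<open>r\<close>-sets that do not arise
  by stretching such a subset therefore contain no clique.

  Alternating pattern. Move the vertices of an edge simultaneously, each by one step in the
  direction given by its sign. Neighbouring blocks move towards each other or away from each
  other, so that any two edges of such a line are separated because both are edges. Hence a
  clique-free family has at most \<open>m - 1\<close> members on a line, whereas every line that meets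
  the family deleted for the lower bound contains \<open>m - 1\<close> edges that are not deleted. The upper
  bound follows line by line.

  General upper bound. The problem is already present for graphs: a graph on \<open>N\<close> vertices
  without \<open>k + 1\<close> pairwise crossing edges has at most \<open>2 * k * N\<close> edges. This is proved by a
  counting version of the Robinson-Schensted-Knuth correspondence. A local rule
  transforms a filling of the adjacency staircase with natural numbers into another
  filling and \<open>2 * n\<close> boundary numbers, where \<open>n = N - 1\<close> is the size of the staircase. The
  transformation is injective, and every chain in the support of the new filling can be
  lengthened by one in the support of the old filling (\<open>bumped_chain_lengthen\<close>). After \<open>k\<close>
  applications nothing but \<open>2 * k * n\<close> boundary numbers remains, and these are linearly
  bounded in the largest entry. Comparing the growth of the number of fillings gives the bound
  (\<open>card_chain_free_le\<close>).

  For larger \<open>r\<close>, let \<open>i, i + 1\<close> be the closest consecutive vertices of an edge, and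
  remove vertex \<open>i + 1\<close>. If all gaps of the remaining vertices are at least \<open>8 * w\<close>, then these
  can be moved in lockstep, each in the direction of its sign, within a window of length \<open>w\<close>.
  Among edges that differ only in this way and in vertex \<open>i + 1\<close>, a clique is the same as a
  family whose pairs of vertices \<open>i, i + 1\<close> cross or nest pairwise, so that there are only
  \<open>O(w * k)\<close> of them (\<open>lockstep_fibre_le\<close>). If \<open>w\<close> is chosen as large as possible, then some
  gap between the remaining vertices is smaller than \<open>16 * w\<close>, so that a lockstep class is
  determined by an \<open>(r - 2)\<close>-set, up to a bounded number of choices and the at most \<open>r\<^sup>2\<close> positions of the two
  gaps (\<open>class_le\<close>). The sum over \<open>w = 2 ^ a\<close> is geometric and dominated by
  \<open>w\<close> about \<open>n / r\<close>, which yields the claim (\<open>clique_free_le\<close>).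
\<close>

section \<open>Vertices of an edge by rank, and counting by fibres\<close>

definition elt :: "'a::linorder set \<Rightarrow> nat \<Rightarrow> 'a" where
  "elt e i = sorted_list_of_set e ! i"

lemma elt_mono: "i < j \<Longrightarrow> j < card e \<Longrightarrow> elt e i < elt e j"
  unfolding elt_def
  by (metis length_sorted_list_of_set sorted_wrt_nth_less strict_sorted_list_of_set)

lemma elt_image: "finite e \<Longrightarrow> card e = r \<Longrightarrow> elt e ` {..<r} = e"
  unfolding elt_def
  by (metis length_sorted_list_of_set atLeast_upt list.set_map map_nth set_sorted_list_of_set)

lemma elt_mem: "finite e \<Longrightarrow> i < card e \<Longrightarrow> elt e i \<in> e"
  using elt_image by blast

lemma elt_of_strict_mono:
  assumes "\<And>i j. i < j \<Longrightarrow> j < r \<Longrightarrow> x i < x j" "i < r"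
  shows "elt (x ` {..<r}) i = x i"
proof -
  have "sorted_wrt (<) (map x [0..<r])"
    using assms(1) by (simp add: sorted_wrt_iff_nth_less)
  then have "sorted_list_of_set (set (map x [0..<r])) = map x [0..<r]"
    by (meson sorted_list_of_set.idem_if_sorted_distinct strict_sorted_iff)
  then show ?thesis using assms(2) by (simp add: elt_def lessThan_atLeast0)
qed

lemma card_strict_mono_image:
  fixes x :: "nat \<Rightarrow> 'a::linorder"
  assumes "\<And>i j. i < j \<Longrightarrow> j < r \<Longrightarrow> x i < x j"
  shows "card (x ` {..<r}) = r"
proof -
  have "inj_on x {..<r}"
    by (rule linorder_inj_onI) (use assms in \<open>force+\<close>)
  then show ?thesis by (simp add: card_image)
qed

lemma elt_strict_mono_on_image:
  assumes "strict_mono_on e f" "finite e" "i < card e"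
  shows "elt (f ` e) i = f (elt e i)"
proof -
  have "f ` e = (\<lambda>i. f (elt e i)) ` {..<card e}"
    using elt_image[OF assms(2) refl] by (metis image_image)
  then show ?thesis
    using elt_of_strict_mono[of "card e" "\<lambda>i. f (elt e i)" i] assms
    by (simp add: strict_mono_onD elt_mono elt_mem)
qed

lemma elt_inject:
  assumes "finite e" "finite f" "card e = r" "card f = r" "\<And>i. i < r \<Longrightarrow> elt e i = elt f i"
  shows "e = f"
  using elt_image[OF assms(1,3)] elt_image[OF assms(2,4)] assms(5)
  by (metis (no_types, lifting) image_cong lessThan_iff)

lemma card_le_fibres:
  assumes "finite F" "finite T" "\<And>x. x \<in> F \<Longrightarrow> h x \<in> T"
    and "\<And>y. y \<in> T \<Longrightarrow> card {x \<in> F. h x = y} \<le> w y"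
  shows "card F \<le> (\<Sum>y\<in>T. w y)"
proof -
  have "F = (\<Union>y\<in>T. {x \<in> F. h x = y})" using assms(3) by auto
  then have "card F = card (\<Union>y\<in>T. {x \<in> F. h x = y})" by (rule arg_cong)
  also have "\<dots> \<le> (\<Sum>y\<in>T. card {x \<in> F. h x = y})"
    by (rule card_UN_le[OF assms(2)])
  also have "\<dots> \<le> (\<Sum>y\<in>T. w y)" by (intro sum_mono assms(4))
  finally show ?thesis .
qed

lemma card_le_by_fibres:
  assumes "finite S" "finite T" "\<And>y. card {x \<in> S. h x = y} \<le> card {x \<in> T. h x = y}"
  shows "card S \<le> card T"
proof -
  have sum: "card C = (\<Sum>y\<in>h ` S \<union> h ` T. card {x \<in> C. h x = y})" if "C \<subseteq> S \<union> T" for C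
  proof -
    have "finite C" using that assms finite_subset by blast
    then have "card C = (\<Sum>x\<in>C. 1)" by simp
    also have "\<dots> = (\<Sum>y\<in>h ` S \<union> h ` T. \<Sum>x\<in>{x \<in> C. h x = y}. 1)"
      by (rule sum.group[symmetric]) (use \<open>finite C\<close> that assms in auto)
    finally show ?thesis by simp
  qed
  show ?thesis using sum[of S] sum[of T] assms(3) by (simp add: sum_mono)
qed

section \<open>Cliques of a sign pattern\<close>

text \<open>The edge \<open>e\<close> plays the role of the first edge of the pattern. Separation is demanded only
between neighbouring blocks, because the vertices of a single edge carry it further.\<close>

definition follows_pattern :: "nat \<Rightarrow> (nat \<Rightarrow> bool) \<Rightarrow> 'a::linorder set \<Rightarrow> 'a set \<Rightarrow> bool" where
  "follows_pattern r s e f \<longleftrightarrow>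
     (\<forall>i<r. elt e i \<noteq> elt f i \<and> (elt e i < elt f i \<longleftrightarrow> s i)) \<and>
     (\<forall>i. Suc i < r \<longrightarrow> elt e i < elt f (Suc i) \<and> elt f i < elt e (Suc i))"

definition pattern_clique :: "nat \<Rightarrow> (nat \<Rightarrow> bool) \<Rightarrow> 'a::linorder set set \<Rightarrow> bool" where
  "pattern_clique r s K \<longleftrightarrow> finite K \<and> (\<forall>e\<in>K. finite e \<and> card e = r) \<and>
     (\<forall>e\<in>K. \<forall>f\<in>K. e \<noteq> f \<longrightarrow> follows_pattern r s e f \<or> follows_pattern r s f e)"

lemma pattern_clique_separated:
  assumes K: "pattern_clique r s K" "e \<in> K" "f \<in> K" and "k < k'" "k' < r"
  shows "elt e k < elt f k'"
proof -
  have c: "card e = r" "card f = r" using K by (auto simp: pattern_clique_def)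
  show ?thesis
  proof (cases "e = f")
    case True
    then show ?thesis using elt_mono assms c by blast
  next
    case False
    then have "follows_pattern r s e f \<or> follows_pattern r s f e"
      using K unfolding pattern_clique_def by blast
    then have "elt e k < elt f (Suc k)"
      using assms(4,5) by (auto simp: follows_pattern_def)
    also have "\<dots> \<le> elt f k'"
      using elt_mono[of "Suc k" k' f] assms(4,5) c by (cases "Suc k = k'") auto
    finally show ?thesis .
  qed
qed

lemma pattern_clique_less_iff:
  assumes K: "pattern_clique r s K" "e \<in> K" "f \<in> K" and "e \<noteq> f" "i < r" "s 0"
  shows "elt e i \<noteq> elt f i" "elt e i < elt f i \<longleftrightarrow> (s i \<longleftrightarrow> elt e 0 < elt f 0)"
proof -
  have "0 < r" using assms(5) by simp
  moreover have "follows_pattern r s e f \<or> follows_pattern r s f e"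
    using K assms(4) by (auto simp: pattern_clique_def)
  ultimately show "elt e i \<noteq> elt f i" "elt e i < elt f i \<longleftrightarrow> (s i \<longleftrightarrow> elt e 0 < elt f 0)"
    using assms(5,6) unfolding follows_pattern_def by force+
qed

definition index_in :: "'a::linorder set set \<Rightarrow> 'a set \<Rightarrow> nat" where
  "index_in K e = card {f \<in> K. elt f 0 < elt e 0}"

definition standard_position :: "(nat \<Rightarrow> bool) \<Rightarrow> nat \<Rightarrow> nat \<Rightarrow> nat \<Rightarrow> nat" where
  "standard_position s m j i = i * m + (if s i then j else m - 1 - j)"

lemma pattern_clique_inj:
  assumes "pattern_clique r s K" "s 0"
  shows "inj_on (\<lambda>(k, f). elt f k) ({..<r} \<times> K)"
proof (rule inj_onI, clarify)
  fix k f k' f' assume "k < r" "f \<in> K" "k' < r" "f' \<in> K" and eq: "elt f k = elt f' k'"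
  then have "k = k'"
    using pattern_clique_separated[OF assms(1)] by (metis less_irrefl linorder_neqE_nat)
  moreover have "f = f'"
    using pattern_clique_less_iff(1)[OF assms(1) \<open>f \<in> K\<close> \<open>f' \<in> K\<close> _ \<open>k < r\<close> assms(2)] eq \<open>k = k'\<close> by blast
  ultimately show "k = k' \<and> f = f'" by simp
qed

lemma pattern_clique_Union:
  assumes "pattern_clique r s K"
  shows "\<Union>K = (\<lambda>(k, f). elt f k) ` ({..<r} \<times> K)"
proof -
  have "e = (\<lambda>k. elt e k) ` {..<r}" if "e \<in> K" for e
    using assms that elt_image by (metis pattern_clique_def)
  then have "\<Union>K = (\<Union>e\<in>K. elt e ` {..<r})" by blast
  then show ?thesis by auto
qed

lemma card_pattern_clique_Union:
  assumes "pattern_clique r s K" "s 0"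
  shows "card (\<Union>K) = r * card K"
  by (simp add: pattern_clique_Union[OF assms(1)] card_image[OF pattern_clique_inj[OF assms]] card_cartesian_product)

text \<open>Below the \<open>i\<close>-th vertex of \<open>e\<close> lie the \<open>i\<close> preceding blocks completely, each with one vertex
of every edge, and those vertices of block \<open>i\<close> that belong to edges with smaller index, or
larger index if the sign is negative. So the index of an edge in block \<open>0\<close> determines the
ranks of all its vertices.\<close>

lemma rank_in_pattern_clique:
  assumes K: "pattern_clique r s K" "e \<in> K" and "i < r" "s 0"
  shows "card {y \<in> \<Union>K. y < elt e i} = standard_position s (card K) (index_in K e) i"
proof -
  let ?below = "{f \<in> K. elt f i < elt e i}"
  let ?g = "\<lambda>(k, f). elt f k"
  have fin: "finite K" using K by (simp add: pattern_clique_def)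
  have "{y \<in> \<Union>K. y < elt e i} = ?g ` ({..<i} \<times> K \<union> {i} \<times> ?below)"
  proof (intro equalityI subsetI)
    fix y assume y: "y \<in> {y \<in> \<Union>K. y < elt e i}"
    then obtain k f where kf: "y = elt f k" "k < r" "f \<in> K"
      using pattern_clique_Union[OF K(1)] by auto
    have "\<not> i < k" using pattern_clique_separated[OF K kf(3), of i k] y kf by auto
    then show "y \<in> ?g ` ({..<i} \<times> K \<union> {i} \<times> ?below)"
      using y kf by (cases "k = i") (auto intro!: image_eqI[of _ _ "(k, f)"])
  next
    fix y assume "y \<in> ?g ` ({..<i} \<times> K \<union> {i} \<times> ?below)"
    then obtain k f where kf: "y = elt f k" "f \<in> K" "k < i \<or> k = i \<and> elt f i < elt e i" by auto
    then have "y < elt e i"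
      using pattern_clique_separated[OF K(1) kf(2) K(2), of k i] assms(3) by auto
    moreover have "y \<in> \<Union>K"
      using kf assms(3) pattern_clique_Union[OF K(1)] by (auto intro!: image_eqI[of _ _ "(k, f)"])
    ultimately show "y \<in> {y \<in> \<Union>K. y < elt e i}" by simp
  qed
  moreover have "inj_on ?g ({..<i} \<times> K \<union> {i} \<times> ?below)"
    by (rule inj_on_subset[OF pattern_clique_inj[OF K(1) assms(4)]]) (use assms(3) in auto)
  ultimately have "card {y \<in> \<Union>K. y < elt e i} = card ({..<i} \<times> K \<union> {i} \<times> ?below)"
    by (simp add: card_image)
  also have "\<dots> = i * card K + card ?below"
    by (subst card_Un_disjoint) (auto simp: fin card_cartesian_product)
  also have "card ?below = (if s i then index_in K e else card K - 1 - index_in K e)"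
  proof (cases "s i")
    case True
    have "?below = {f \<in> K. elt f 0 < elt e 0}"
      using pattern_clique_less_iff(2)[OF K(1) _ K(2) _ assms(3,4)] True by blast
    then show ?thesis using True by (simp add: index_in_def)
  next
    case False
    have "?below = K - {e} - {f \<in> K. elt f 0 < elt e 0}"
      using pattern_clique_less_iff(2)[OF K(1) _ K(2) _ assms(3,4)] False by blast
    moreover have "card (K - {e} - {f \<in> K. elt f 0 < elt e 0})
        = card (K - {e}) - card {f \<in> K. elt f 0 < elt e 0}"
      by (rule card_Diff_subset) (use fin in auto)
    ultimately show ?thesis using False fin K(2) by (simp add: index_in_def)
  qed
  finally show ?thesis by (simp add: standard_position_def)
qed

lemma index_in_bij:
  assumes "pattern_clique r s K" "s 0" "r \<ge> 1"
  shows "bij_betw (index_in K) K {..<card K}"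
proof -
  have fin: "finite K" using assms by (simp add: pattern_clique_def)
  have less: "index_in K e < index_in K f" if "e \<in> K" "f \<in> K" "elt e 0 < elt f 0" for e f
    unfolding index_in_def
    by (rule psubset_card_mono) (use that fin in \<open>auto simp: psubset_eq\<close>)
  have "inj_on (index_in K) K"
  proof (rule inj_onI, rule ccontr)
    fix e f assume ef: "e \<in> K" "f \<in> K" "index_in K e = index_in K f" "e \<noteq> f"
    then have "elt e 0 \<noteq> elt f 0"
      using pattern_clique_less_iff(1)[OF assms(1) ef(1,2,4), of 0] assms by simp
    then show False using less[OF ef(1,2)] less[OF ef(2,1)] ef(3) by (metis less_irrefl linorder_neqE)
  qed
  moreover have "index_in K e < card K" if "e \<in> K" for e
    unfolding index_in_def by (rule psubset_card_mono) (use that fin in \<open>auto simp: psubset_eq\<close>)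
  then have "index_in K ` K \<subseteq> {..<card K}" by auto
  ultimately show ?thesis
    using card_subset_eq[of "{..<card K}" "index_in K ` K"] by (simp add: bij_betw_def card_image)
qed

text \<open>The shift by one accounts for vertex sets that start at \<open>1\<close>.\<close>

definition standard_edge :: "nat \<Rightarrow> (nat \<Rightarrow> bool) \<Rightarrow> nat \<Rightarrow> nat \<Rightarrow> nat set" where
  "standard_edge r s m j = (\<lambda>i. standard_position s m j i + 1) ` {..<r}"

definition standard_clique :: "nat \<Rightarrow> (nat \<Rightarrow> bool) \<Rightarrow> nat \<Rightarrow> nat ograph" where
  "standard_clique r s m = \<lparr>verts = {1..r * m}, edges = standard_edge r s m ` {..<m}\<rparr>"

lemma standard_position_mono:
  assumes "i < i'" "j < m" "j' < m"
  shows "standard_position s m j i < standard_position s m j' i'"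
proof -
  have "standard_position s m j i < i * m + m" using assms by (auto simp: standard_position_def)
  also have "\<dots> = Suc i * m" by simp
  also have "\<dots> \<le> i' * m" using assms(1) by (intro mult_right_mono) auto
  also have "\<dots> \<le> standard_position s m j' i'" by (simp add: standard_position_def)
  finally show ?thesis .
qed

lemma elt_standard_edge:
  assumes "j < m" "i < r"
  shows "elt (standard_edge r s m j) i = standard_position s m j i + 1"
  unfolding standard_edge_def
  by (rule elt_of_strict_mono) (use assms standard_position_mono in auto)

lemma follows_pattern_standard:
  assumes "j < j'" "j' < m"
  shows "follows_pattern r s (standard_edge r s m j) (standard_edge r s m j')"
  using assms standard_position_mono[of _ _ j m j' s] standard_position_mono[of _ _ j' m j s]
  by (auto simp: follows_pattern_def elt_standard_edge standard_position_def)

lemma pattern_clique_standard: "pattern_clique r s (standard_edge r s m ` {..<m})"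
  unfolding pattern_clique_def
proof (intro conjI ballI impI)
  fix e assume "e \<in> standard_edge r s m ` {..<m}"
  then obtain j where j: "j < m" "e = standard_edge r s m j" by auto
  then show "card e = r"
    unfolding j(2) standard_edge_def
    by (intro card_strict_mono_image) (use j(1) standard_position_mono in auto)
  fix f assume "f \<in> standard_edge r s m ` {..<m}" "e \<noteq> f"
  then obtain j' where j': "j' < m" "f = standard_edge r s m j'" "j \<noteq> j'" using j by auto
  then show "follows_pattern r s e f \<or> follows_pattern r s f e"
    using follows_pattern_standard j by (metis linorder_neqE_nat)
qed (auto simp: standard_edge_def)

lemma card_standard_edges: "r \<ge> 1 \<Longrightarrow> s 0 \<Longrightarrow> card (standard_edge r s m ` {..<m}) = m"
proof -
  assume "r \<ge> 1" "s 0"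
  have "inj_on (standard_edge r s m) {..<m}"
  proof (rule inj_onI)
    fix j j' assume "j \<in> {..<m}" "j' \<in> {..<m}" "standard_edge r s m j = standard_edge r s m j'"
    then have "standard_position s m j 0 + 1 = standard_position s m j' 0 + 1"
      using \<open>r \<ge> 1\<close> elt_standard_edge[of _ m 0 r s] by (metis lessThan_iff less_eq_Suc_le One_nat_def)
    then show "j = j'" using \<open>s 0\<close> by (simp add: standard_position_def)
  qed
  then show ?thesis by (simp add: card_image)
qed

lemma Union_standard_edges:
  assumes "r \<ge> 1" "s 0"
  shows "\<Union>(standard_edge r s m ` {..<m}) = {1..r * m}"
proof -
  have "\<Union>(standard_edge r s m ` {..<m}) \<subseteq> {1..r * m}"
  proof
    fix x assume "x \<in> \<Union>(standard_edge r s m ` {..<m})"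
    then obtain j where "j \<in> {..<m}" "x \<in> standard_edge r s m j" by blast
    then obtain i where i: "i < r" "x = standard_position s m j i + 1" by (auto simp: standard_edge_def)
    have "standard_position s m j i < i * m + m" using \<open>j \<in> {..<m}\<close> by (auto simp: standard_position_def)
    also have "\<dots> = Suc i * m" by simp
    also have "\<dots> \<le> r * m" using i by (intro mult_right_mono) auto
    finally show "x \<in> {1..r * m}" using i by simp
  qed
  moreover have "card (\<Union>(standard_edge r s m ` {..<m})) = card {1..r * m}"
    using card_pattern_clique_Union[where s = s, OF pattern_clique_standard assms(2)]
      card_standard_edges[where s = s, OF assms] by simp
  ultimately show ?thesis by (intro card_subset_eq) simp_all
qed

definition rank_in :: "'a::linorder set \<Rightarrow> 'a \<Rightarrow> nat" where
  "rank_in V y = card {z \<in> V. z < y} + 1"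

lemma rank_in_strict_mono: "finite V \<Longrightarrow> strict_mono_on V (rank_in V)"
  unfolding rank_in_def
  by (intro strict_mono_onI add_strict_right_mono psubset_card_mono) (auto simp: psubset_eq)

lemma rank_in_bij: 
  assumes "finite V" 
  shows "bij_betw (rank_in V) V {1..card V}"
proof -
  have "inj_on (rank_in V) V" using rank_in_strict_mono[OF assms] strict_mono_on_imp_inj_on by blast
  moreover have "rank_in V y \<in> {1..card V}" if "y \<in> V" for y
  proof -
    have "card {z \<in> V. z < y} < card V"
      by (rule psubset_card_mono) (use that assms in \<open>auto simp: psubset_eq\<close>)
    then show ?thesis by (simp add: rank_in_def)
  qed
  then have "rank_in V ` V \<subseteq> {1..card V}" by blast
  ultimately show ?thesis
    using card_subset_eq[of "{1..card V}" "rank_in V ` V"] by (simp add: bij_betw_def card_image)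
qed

text \<open>Ranking the vertices of a clique produces one and the same matching on an initial segment,
whatever the clique. This gives both the uniqueness of the clique graph and the
isomorphisms that are needed to find it inside another graph.\<close>

lemma rank_image_pattern_clique:
  assumes K: "pattern_clique r s K" and "s 0" "r \<ge> 1"
  shows "(`) (rank_in (\<Union>K)) ` K = standard_edge r s (card K) ` {..<card K}"
proof -
  have "rank_in (\<Union>K) ` e = standard_edge r s (card K) (index_in K e)" if e: "e \<in> K" for e
  proof -
    have "e = elt e ` {..<r}" using K e elt_image by (metis pattern_clique_def)
    then have "rank_in (\<Union>K) ` e = (\<lambda>i. rank_in (\<Union>K) (elt e i)) ` {..<r}" by (metis image_image)
    then show ?thesis
      using rank_in_pattern_clique[OF K e _ assms(2)] by (simp add: standard_edge_def rank_in_def)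
  qed
  then have "(`) (rank_in (\<Union>K)) ` K = standard_edge r s (card K) ` index_in K ` K"
    by (simp add: image_image)
  then show ?thesis using index_in_bij[OF assms] by (simp add: bij_betw_def)
qed

lemma pattern_clique_isomorphic_standard:
  assumes K: "pattern_clique r s K" and "s 0" "r \<ge> 1"
  shows "order_isomorphic \<lparr>verts = \<Union>K, edges = K\<rparr> (standard_clique r s (card K))"
proof -
  have "finite (\<Union>K)" using K by (auto simp: pattern_clique_def)
  then show ?thesis unfolding order_isomorphic_def
    using rank_in_bij[of "\<Union>K"] rank_in_strict_mono[of "\<Union>K"] rank_image_pattern_clique[OF assms]
      card_pattern_clique_Union[OF K assms(2)]
    by (intro exI[of _ "rank_in (\<Union>K)"]) (simp add: standard_clique_def)
qed

lemma follows_pattern_image: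
  assumes "strict_mono_on V \<phi>" "e \<subseteq> V" "f \<subseteq> V" "finite e" "finite f" "card e = r" "card f = r"
  shows "follows_pattern r s (\<phi> ` e) (\<phi> ` f) \<longleftrightarrow> follows_pattern r s e f"
proof -
  have sub: "elt e i \<in> V" "elt f i \<in> V" if "i < r" for i
    using elt_mem[of e i] elt_mem[of f i] that assms by auto
  have "elt (\<phi> ` e) i = \<phi> (elt e i)" "elt (\<phi> ` f) i = \<phi> (elt f i)" if "i < r" for i
    using that assms monotone_on_subset[OF assms(1)] by (simp_all add: elt_strict_mono_on_image)
  moreover have "\<phi> x < \<phi> y \<longleftrightarrow> x < y" "\<phi> x = \<phi> y \<longleftrightarrow> x = y" if "x \<in> V" "y \<in> V" for x y
    using strict_mono_on_less[OF assms(1) that] strict_mono_on_eq[OF assms(1) that] by auto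
  ultimately show ?thesis using sub by (simp add: follows_pattern_def)
qed

lemma pattern_clique_image:
  assumes "strict_mono_on V \<phi>" "\<And>e. e \<in> K \<Longrightarrow> e \<subseteq> V \<and> finite e" "finite K"
  shows "pattern_clique r s ((`) \<phi> ` K) \<longleftrightarrow> pattern_clique r s K"
proof -
  have inj: "inj_on \<phi> V" using assms(1) strict_mono_on_imp_inj_on by blast
  have card: "card (\<phi> ` e) = card e" if "e \<in> K" for e
    using assms(2)[OF that] inj by (meson card_image inj_on_subset)
  have eq: "\<phi> ` e = \<phi> ` f \<longleftrightarrow> e = f" if "e \<in> K" "f \<in> K" for e f
    using inj_on_image_eq_iff[OF inj] assms(2) that by blast
  have fp: "follows_pattern r s (\<phi> ` e) (\<phi> ` f) \<longleftrightarrow> follows_pattern r s e f"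
    if "e \<in> K" "f \<in> K" "card e = r" "card f = r" for e f
    using follows_pattern_image[OF assms(1)] assms(2) that by blast
  have fin: "finite (\<phi> ` e) \<longleftrightarrow> finite e" if "e \<in> K" for e using assms(2)[OF that] by simp
  show ?thesis
  proof (cases "\<forall>e\<in>K. card e = r")
    case True
    then show ?thesis
      unfolding pattern_clique_def ball_simps using assms(2,3)
      by (simp add: card eq fp cong: ball_cong)
  next
    case False
    then obtain e where "e \<in> K" "card e \<noteq> r" "card (\<phi> ` e) \<noteq> r" using card by auto
    then show ?thesis unfolding pattern_clique_def by blast
  qed
qed

lemma pattern_clique_subset: "pattern_clique r s K \<Longrightarrow> K' \<subseteq> K \<Longrightarrow> pattern_clique r s K'"
  unfolding pattern_clique_def using finite_subset by blast

lemma standard_clique_of_clique: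
  assumes "pattern_clique r s (edges M)" "s 0" "r \<ge> 1" "card (edges M) = m" 
    "verts M = {1..r * m}" "\<Union>(edges M) = verts M"
  shows "M = standard_clique r s m"
proof -
  have "rank_in (\<Union>(edges M)) y = y" if "y \<in> {1..r * m}" for y
  proof -
    have "{z \<in> {1..r * m}. z < y} = {1..<y}" using that by auto
    then show ?thesis using assms(5,6) that by (simp add: rank_in_def)
  qed
  then have "rank_in (\<Union>(edges M)) ` e = (\<lambda>y. y) ` e" if "e \<in> edges M" for e
    by (intro image_cong refl) (use that assms(5,6) in blast)
  then have "(`) (rank_in (\<Union>(edges M))) ` edges M = edges M" by simp
  then show ?thesis
    using rank_image_pattern_clique[OF assms(1-3)] assms(4,5) by (simp add: standard_clique_def)
qed

lemma isomorphic_standard_imp_pattern_clique: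
  assumes iso: "order_isomorphic G (standard_clique r s m)"
    and "\<And>e. e \<in> edges G \<Longrightarrow> e \<subseteq> verts G" "r \<ge> 1" "s 0"
  shows "pattern_clique r s (edges G)" "card (edges G) = m"
proof -
  obtain \<phi> where \<phi>: "bij_betw \<phi> (verts G) {1..r * m}" "strict_mono_on (verts G) \<phi>"
    "(`) \<phi> ` edges G = standard_edge r s m ` {..<m}"
    using iso by (auto simp: order_isomorphic_def standard_clique_def)
  have fin: "finite (verts G)" using \<phi>(1) bij_betw_finite by blast
  have "edges G \<subseteq> Pow (verts G)" using assms(2) by blast
  then have fin': "finite (edges G)" using fin finite_subset by blast
  have sub: "e \<subseteq> verts G \<and> finite e" if "e \<in> edges G" for e
    using assms(2)[OF that] finite_subset[OF _ fin] by blast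
  have "pattern_clique r s ((`) \<phi> ` edges G)"
    unfolding \<phi>(3) by (rule pattern_clique_standard)
  then show "pattern_clique r s (edges G)"
    using pattern_clique_image[OF \<phi>(2) sub fin', of r s] by simp
  have "inj_on \<phi> (verts G)" using \<phi>(1) by (simp add: bij_betw_def)
  then have "inj_on ((`) \<phi>) (edges G)"
    using assms(2) by (intro inj_onI) (simp add: inj_on_image_eq_iff)
  then have "card ((`) \<phi> ` edges G) = card (edges G)" by (rule card_image)
  then show "card (edges G) = m"
    unfolding \<phi>(3) using card_standard_edges[of r s m] assms(3,4) by simp
qed

lemma r_matching_standard:
  assumes "r \<ge> 1" "s 0"
  shows "r_matching r (standard_clique r s m)"
proof -
  let ?E = "standard_edge r s m ` {..<m}"
  note K = pattern_clique_standard[of r s m]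
  have Un: "\<Union>?E = {1..r * m}" by (rule Union_standard_edges[where s = s, OF assms])
  have card: "finite e \<and> card e = r" if "e \<in> ?E" for e
    using K that unfolding pattern_clique_def by blast
  have uniq: "f = e" if e: "e \<in> ?E" "v \<in> e" and f: "f \<in> ?E" "v \<in> f" for e f v
  proof -
    have "v \<in> elt e ` {..<r}" using card[OF e(1)] e(2) by (simp add: elt_image)
    then obtain k where "k < r" "v = elt e k" by auto
    have "v \<in> elt f ` {..<r}" using card[OF f(1)] f(2) by (simp add: elt_image)
    then obtain k' where "k' < r" "v = elt f k'" by auto
    note kk = \<open>k < r\<close> \<open>v = elt e k\<close> \<open>k' < r\<close> \<open>v = elt f k'\<close>
    then show ?thesis
      using inj_onD[OF pattern_clique_inj[where s = s, OF K assms(2)], of "(k, e)" "(k', f)"] e f kk by simp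
  qed
  have "\<exists>!e. e \<in> ?E \<and> v \<in> e" if "v \<in> {1..r * m}" for v
  proof -
    have "v \<in> \<Union>?E" using that Un by blast
    then obtain e where "e \<in> ?E" "v \<in> e" by (rule UnionE)
    then show ?thesis using uniq by (intro ex1I[of _ e]) blast+
  qed
  moreover have "e \<subseteq> {1..r * m}" if "e \<in> ?E" for e using Un that by blast
  ultimately show ?thesis
    using card unfolding r_matching_def ordered_rgraph_def standard_clique_def by simp
qed

text \<open>The pattern itself is the standard clique with two edges, so that both directions are the
statements about standard cliques, applied to pairs of edges.\<close>

lemma is_clique_iff_pattern_clique:
  assumes M: "r_matching r M" and "r \<ge> 1" "s 0"
  shows "is_clique r (standard_clique r s 2) M \<longleftrightarrow> pattern_clique r s (edges M)"
proof
  have fin: "finite (edges M)" "\<And>e. e \<in> edges M \<Longrightarrow> finite e \<and> card e = r"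
  proof -
    have V: "finite (verts M)" "\<forall>e\<in>edges M. e \<subseteq> verts M \<and> card e = r"
      using M by (auto simp: r_matching_def ordered_rgraph_def)
    then have "edges M \<subseteq> Pow (verts M)" by blast
    then show "finite (edges M)" using V(1) finite_subset by blast
    show "\<And>e. e \<in> edges M \<Longrightarrow> finite e \<and> card e = r" using V finite_subset by blast
  qed
  {
    assume cl: "is_clique r (standard_clique r s 2) M"
    show "pattern_clique r s (edges M)"
      unfolding pattern_clique_def
    proof (intro conjI ballI impI fin)
      fix e f assume ef: "e \<in> edges M" "f \<in> edges M" "e \<noteq> f"
      let ?G = "\<lparr>verts = e \<union> f, edges = {e, f}\<rparr>"
      have "order_isomorphic ?G (standard_clique r s 2)" using cl ef by (auto simp: is_clique_def)
      from isomorphic_standard_imp_pattern_clique(1)[OF this _ assms(2,3)]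
      have "pattern_clique r s {e, f}" by auto
      then show "follows_pattern r s e f \<or> follows_pattern r s f e"
        using ef(3) unfolding pattern_clique_def by blast
    qed (use fin in auto)
  next
    assume K: "pattern_clique r s (edges M)"
    show "is_clique r (standard_clique r s 2) M"
      unfolding is_clique_def
    proof (intro conjI ballI impI M)
      fix e f assume ef: "e \<in> edges M" "f \<in> edges M" "e \<noteq> f"
      have "pattern_clique r s {e, f}" by (rule pattern_clique_subset[OF K]) (use ef in auto)
      from pattern_clique_isomorphic_standard[OF this assms(3,2)]
      show "order_isomorphic \<lparr>verts = e \<union> f, edges = {e, f}\<rparr> (standard_clique r s 2)"
        using ef(3) by (simp add: card_insert_if numeral_2_eq_2)
    qed
  }
qed

lemma clique_graph_standard:
  assumes "r \<ge> 1" "s 0"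
  shows "clique_graph r (standard_clique r s 2) m = standard_clique r s m"
  unfolding clique_graph_def
proof (rule the_equality)
  let ?M = "standard_clique r s m"
  have "edges ?M = standard_edge r s m ` {..<m}" by (simp add: standard_clique_def)
  then have "is_clique r (standard_clique r s 2) ?M" "card (edges ?M) = m"
    using is_clique_iff_pattern_clique[where s = s, OF r_matching_standard[where s = s, OF assms] assms]
      pattern_clique_standard[of r s m] card_standard_edges[of r s m] assms by simp_all
  then show "verts ?M = {1..r * m} \<and> is_clique r (standard_clique r s 2) ?M \<and> card (edges ?M) = m"
    by (simp add: standard_clique_def)
next
  fix M :: "nat ograph"
  assume M: "verts M = {1..r * m} \<and> is_clique r (standard_clique r s 2) M \<and> card (edges M) = m"
  then have match: "r_matching r M" by (simp add: is_clique_def)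
  have "\<Union>(edges M) = verts M"
  proof
    show "\<Union>(edges M) \<subseteq> verts M" using match by (auto simp: r_matching_def ordered_rgraph_def)
    show "verts M \<subseteq> \<Union>(edges M)" using match by (fastforce simp: r_matching_def)
  qed
  then show "M = standard_clique r s m"
    using M standard_clique_of_clique[of r s M m] is_clique_iff_pattern_clique[where s = s, OF match assms] assms by simp
qed

section \<open>Extremal numbers as sizes of clique-free families\<close>

definition clique_free :: "nat \<Rightarrow> (nat \<Rightarrow> bool) \<Rightarrow> nat \<Rightarrow> 'a::linorder set set \<Rightarrow> bool" where
  "clique_free r s m F \<longleftrightarrow> \<not> (\<exists>K\<subseteq>F. pattern_clique r s K \<and> card K = m)"

lemma is_free_standard_iff:
  assumes G: "ordered_rgraph r G" and "r \<ge> 1" "s 0"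
  shows "is_free (standard_clique r s m) G \<longleftrightarrow> clique_free r s m (edges G)"
proof -
  have "(\<exists>H. subgraph H G \<and> order_isomorphic H (standard_clique r s m)) \<longleftrightarrow>
        (\<exists>K\<subseteq>edges G. pattern_clique r s K \<and> card K = m)"
  proof
    assume "\<exists>H. subgraph H G \<and> order_isomorphic H (standard_clique r s m)"
    then obtain H where H: "subgraph H G" "order_isomorphic H (standard_clique r s m)" by blast
    have "edges H \<subseteq> edges G" "\<And>e. e \<in> edges H \<Longrightarrow> e \<subseteq> verts H" using H(1) by (auto simp: subgraph_def)
    then show "\<exists>K\<subseteq>edges G. pattern_clique r s K \<and> card K = m"
      using isomorphic_standard_imp_pattern_clique[OF H(2) _ assms(2,3)] by blast
  next
    assume "\<exists>K\<subseteq>edges G. pattern_clique r s K \<and> card K = m"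
    then obtain K where K: "K \<subseteq> edges G" "pattern_clique r s K" "card K = m" by blast
    let ?H = "\<lparr>verts = \<Union>K, edges = K\<rparr>"
    have "\<Union>K \<subseteq> verts G" using G K(1) by (fastforce simp: ordered_rgraph_def)
    then have "subgraph ?H G" using K(1) by (auto simp: subgraph_def)
    then show "\<exists>H. subgraph H G \<and> order_isomorphic H (standard_clique r s m)"
      using pattern_clique_isomorphic_standard[OF K(2) assms(3,2)] K(3) by blast
  qed
  then show ?thesis by (simp add: is_free_def clique_free_def)
qed

lemma finite_edges_ordered_rgraph:
  assumes "ordered_rgraph r G"
  shows "finite (edges G)" "card (edges G) \<le> card (verts G) choose r"
proof -
  have V: "finite (verts G)" and sub: "edges G \<subseteq> {e. e \<subseteq> verts G \<and> card e = r}"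
    using assms by (auto simp: ordered_rgraph_def)
  have "finite {e. e \<subseteq> verts G \<and> card e = r}" using V by simp
  then show "finite (edges G)" using sub finite_subset by blast
  show "card (edges G) \<le> card (verts G) choose r"
    using card_mono[OF \<open>finite {e. e \<subseteq> verts G \<and> card e = r}\<close> sub] n_subsets[OF V, of r] by simp
qed

lemma finite_edge_counts:
  "finite {card (edges G) |G :: nat ograph. ordered_rgraph r G \<and> card (verts G) = n \<and> is_free F G}"
  by (rule finite_subset[of _ "{..n choose r}"]) (use finite_edges_ordered_rgraph(2) in auto)

lemma ex_less_standard_ge:
  fixes F :: "nat set set"
  assumes "F \<subseteq> {e. e \<subseteq> {1..n} \<and> card e = r}" "clique_free r s m F" "r \<ge> 1" "s 0"
  shows "card F \<le> ex_less r n (standard_clique r s m)"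
proof -
  let ?G = "\<lparr>verts = {1..n}, edges = F\<rparr>"
  have G: "ordered_rgraph r ?G" using assms(1) by (auto simp: ordered_rgraph_def)
  have "is_free (standard_clique r s m) ?G"
    using is_free_standard_iff[where s = s and m = m, OF G assms(3,4)] assms(2) by (simp only: ograph.simps)
  then have "ordered_rgraph r ?G \<and> card (verts ?G) = n \<and> is_free (standard_clique r s m) ?G"
    using G by simp
  moreover have "card F = card (edges ?G)" by simp
  ultimately show ?thesis unfolding ex_less_def
    by (intro Max_ge finite_edge_counts) blast
qed

text \<open>Ranking the vertices moves an arbitrary vertex set to \<open>{1..n}\<close> and preserves cliques.\<close>

lemma ex_less_standard_le:
  assumes bound: "\<And>F :: nat set set. F \<subseteq> {e. e \<subseteq> {1..n} \<and> card e = r} \<Longrightarrow> clique_free r s m F \<Longrightarrow> card F \<le> b"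
    and "r \<ge> 1" "s 0" "m \<ge> 1"
  shows "ex_less r n (standard_clique r s m) \<le> b"
proof -
  let ?X = "{card (edges G) |G :: nat ograph.
      ordered_rgraph r G \<and> card (verts G) = n \<and> is_free (standard_clique r s m) G}"
  have "?X \<noteq> {}"
  proof -
    let ?G = "\<lparr>verts = {1..n}, edges = {}\<rparr> :: nat ograph"
    have "ordered_rgraph r ?G" by (simp add: ordered_rgraph_def)
    moreover have "clique_free r s m (edges ?G)" using assms(4) by (simp add: clique_free_def)
    then have "is_free (standard_clique r s m) ?G"
      using is_free_standard_iff[where s = s and m = m, OF \<open>ordered_rgraph r ?G\<close> assms(2,3)] by blast
    moreover have "card (verts ?G) = n" by simp
    ultimately show ?thesis by blast
  qed
  moreover have "card (edges G) \<le> b"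
    if G: "ordered_rgraph r G" "card (verts G) = n" "is_free (standard_clique r s m) G" for G :: "nat ograph"
  proof -
    let ?\<phi> = "rank_in (verts G)"
    have V: "finite (verts G)" "\<And>e. e \<in> edges G \<Longrightarrow> e \<subseteq> verts G \<and> card e = r"
      using G(1) by (auto simp: ordered_rgraph_def)
    have sub: "e \<subseteq> verts G \<and> finite e" if "e \<in> edges G" for e
      using V(2)[OF that] finite_subset[OF _ V(1)] by blast
    note mono = rank_in_strict_mono[OF V(1)]
    have bij: "bij_betw ?\<phi> (verts G) {1..n}" using rank_in_bij[OF V(1)] G(2) by simp
    then have inj: "inj_on ?\<phi> (verts G)" by (simp add: bij_betw_def)
    let ?F = "(`) ?\<phi> ` edges G"
    have inj': "inj_on ((`) ?\<phi>) (edges G)"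
      using V(2) by (intro inj_onI) (simp add: inj_on_image_eq_iff[OF inj])
    have "?F \<subseteq> {e. e \<subseteq> {1..n} \<and> card e = r}"
    proof (rule image_subsetI)
      fix e assume e: "e \<in> edges G"
      have "?\<phi> ` e \<subseteq> {1..n}" using bij V(2)[OF e] by (auto simp: bij_betw_def)
      moreover have "card (?\<phi> ` e) = r"
        using V(2)[OF e] card_image[OF inj_on_subset[OF inj]] by auto
      ultimately show "?\<phi> ` e \<in> {e. e \<subseteq> {1..n} \<and> card e = r}" by simp
    qed
    moreover have "clique_free r s m ?F"
      unfolding clique_free_def
    proof
      assume "\<exists>K\<subseteq>?F. pattern_clique r s K \<and> card K = m"
      then obtain K where K: "K \<subseteq> ?F" "pattern_clique r s K" "m = card K" by blast
      obtain K' where K': "K' \<subseteq> edges G" "K = (`) ?\<phi> ` K'" using K(1) by (meson subset_imageE)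
      have "finite K'" using finite_edges_ordered_rgraph(1)[OF G(1)] K'(1) finite_subset by blast
      then have "pattern_clique r s K'"
        using pattern_clique_image[OF mono, of K' r s] sub K' K(2) by blast
      moreover have "card K' = m" using card_image[OF inj_on_subset[OF inj' K'(1)]] K'(2) K(3) by simp
      moreover have "clique_free r s m (edges G)"
        using is_free_standard_iff[where s = s, OF G(1) assms(2,3)] G(3) by simp
      ultimately show False using K'(1) unfolding clique_free_def by blast
    qed
    ultimately have "card ?F \<le> b" by (rule bound)
    then show ?thesis using card_image[OF inj'] by simp
  qed
  ultimately show ?thesis unfolding ex_less_def
    by (intro Max.boundedI finite_edge_counts) auto
qed

section \<open>Partite patterns as sign sequences\<close>

lemma pattern_blocks:
  assumes "i < r"
  shows "interval_part r {1..2 * r} i = {2 * i + 1, 2 * i + 2}"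
proof -
  have "{u \<in> {1..2 * r}. u < v} = {1..<v}" if "v \<in> {1..2 * r}" for v using that by auto
  then have "card {u \<in> {1..2 * r}. u < v} = v - 1" if "v \<in> {1..2 * r}" for v using that by simp
  then have "interval_part r {1..2 * r} i = {v \<in> {1..2 * r}. i * 2 \<le> v - 1 \<and> v - 1 < (i + 1) * 2}"
    using assms unfolding interval_part_def by (intro Collect_cong) auto
  also have "\<dots> = {2 * i + 1, 2 * i + 2}" using assms by auto
  finally show ?thesis .
qed

lemma standard_edges_2:
  "standard_edge r s 2 ` {..<2} =
     {(\<lambda>i. 2 * i + (if s i then 1 else 2)) ` {..<r}, (\<lambda>i. 2 * i + (if s i then 2 else 1)) ` {..<r}}"
proof -
  have "{..<2::nat} = {0, 1}" by auto
  moreover have "standard_edge r s 2 0 = (\<lambda>i. 2 * i + (if s i then 1 else 2)) ` {..<r}"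
    "standard_edge r s 2 1 = (\<lambda>i. 2 * i + (if s i then 2 else 1)) ` {..<r}"
    unfolding standard_edge_def standard_position_def by (intro image_cong; simp)+
  ultimately show ?thesis by simp
qed

text \<open>Each of the \<open>r\<close> intervals of \<open>{1..2 * r}\<close> consists of two vertices, one from each edge. The sign
of a block records whether the edge through vertex \<open>1\<close> contains the smaller one.\<close>

lemma r_partite_pattern_standard:
  assumes P: "r_pattern r P" "r_partite r P" and "r \<ge> 1"
  obtains s where "s 0" "P = standard_clique r s 2"
proof -
  have V: "verts P = {1..2 * r}" and match: "r_matching r P" and "card (edges P) = 2"
    using P(1) by (auto simp: r_pattern_def)
  have "(1::nat) \<in> verts P" using V assms(3) by simp
  then obtain a where a: "a \<in> edges P" "1 \<in> a" using match unfolding r_matching_def by blast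
  obtain x y where xy: "edges P = {x, y}" "x \<noteq> y"
    using \<open>card (edges P) = 2\<close> unfolding card_2_iff by blast
  define b where "b = (if a = x then y else x)"
  have b: "edges P = {a, b}" "a \<noteq> b" using xy a(1) unfolding b_def by auto
  have sub: "e \<subseteq> {1..2 * r}" if "e \<in> edges P" for e
    using match V that by (auto simp: r_matching_def ordered_rgraph_def)
  have one: "\<exists>v. e \<inter> {2 * i + 1, 2 * i + 2} = {v}" if "e \<in> edges P" "i < r" for e i
  proof -
    have "card (e \<inter> interval_part r {1..2 * r} i) = 1"
      using P(2) that unfolding r_partite_def V by blast
    then show ?thesis unfolding pattern_blocks[OF that(2)] by (rule card_1_singletonE) blast
  qed
  have xor: "(2 * i + 1 \<in> e) \<noteq> (2 * i + 2 \<in> e)" if "e \<in> edges P" "i < r" for e i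
  proof -
    obtain v where v: "e \<inter> {2 * i + 1, 2 * i + 2} = {v}" using one[OF \<open>e \<in> edges P\<close> \<open>i < r\<close>] by blast
    then have "v = 2 * i + 1 \<or> v = 2 * i + 2" by blast
    moreover have "2 * i + 1 \<in> e \<longleftrightarrow> 2 * i + 1 = v" "2 * i + 2 \<in> e \<longleftrightarrow> 2 * i + 2 = v"
      using v by blast+
    moreover have "2 * i + 1 \<noteq> 2 * i + 2" by simp
    ultimately show ?thesis by metis
  qed
  have disj: "x \<notin> b" if "x \<in> a" for x
  proof
    assume "x \<in> b"
    then have "x \<in> verts P" using sub[of b] V b by auto
    then show False using match \<open>x \<in> a\<close> \<open>x \<in> b\<close> b unfolding r_matching_def by blast
  qed
  define s where "s = (\<lambda>i. 2 * i + 1 \<in> a)"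
  have pos: "x \<in> a \<longleftrightarrow> x = 2 * i + (if s i then 1 else 2)" "x \<in> b \<longleftrightarrow> x = 2 * i + (if s i then 2 else 1)"
    if "i < r" "x \<in> {2 * i + 1, 2 * i + 2}" for i x
  proof -
    have "(2 * i + 1 \<in> a) \<noteq> (2 * i + 2 \<in> a)" "(2 * i + 1 \<in> b) \<noteq> (2 * i + 2 \<in> b)"
      using xor that(1) b(1) by auto
    moreover have "2 * i + 1 \<in> a \<Longrightarrow> 2 * i + 1 \<notin> b" "2 * i + 2 \<in> a \<Longrightarrow> 2 * i + 2 \<notin> b"
      using disj by blast+
    moreover have "x = 2 * i + 1 \<or> x = 2 * i + 2" using that(2) by simp
    ultimately show "x \<in> a \<longleftrightarrow> x = 2 * i + (if s i then 1 else 2)" "x \<in> b \<longleftrightarrow> x = 2 * i + (if s i then 2 else 1)"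
      unfolding s_def by (elim disjE; cases "2 * i + 1 \<in> a"; simp)+
  qed
  have split: "x \<in> {2 * ((x - 1) div 2) + 1, 2 * ((x - 1) div 2) + 2} \<and> (x - 1) div 2 < r"
    if "x \<in> {1..2 * r}" for x
  proof -
    have "x = Suc (x - 1)" "x - 1 < 2 * r" using that by auto
    then show ?thesis by (auto; presburger)
  qed
  have "a = (\<lambda>i. 2 * i + (if s i then 1 else 2)) ` {..<r}"
  proof (intro equalityI subsetI)
    fix x assume x: "x \<in> a"
    then have "x \<in> {1..2 * r}" using sub[of a] b(1) by blast
    note i = split[OF this]
    have "x = 2 * ((x - 1) div 2) + (if s ((x - 1) div 2) then 1 else 2)"
      using pos(1)[OF conjunct2[OF i] conjunct1[OF i]] x by (rule iffD1)
    then show "x \<in> (\<lambda>i. 2 * i + (if s i then 1 else 2)) ` {..<r}"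
      by (rule image_eqI) (use i in simp)
  next
    fix x assume "x \<in> (\<lambda>i. 2 * i + (if s i then 1 else 2)) ` {..<r}"
    then obtain i where "i < r" "x = 2 * i + (if s i then 1 else 2)" by auto
    then show "x \<in> a" using pos(1)[of i x] by (auto split: if_splits)
  qed
  moreover have "b = (\<lambda>i. 2 * i + (if s i then 2 else 1)) ` {..<r}"
  proof (intro equalityI subsetI)
    fix x assume x: "x \<in> b"
    then have "x \<in> {1..2 * r}" using sub[of b] b(1) by blast
    note i = split[OF this]
    have "x = 2 * ((x - 1) div 2) + (if s ((x - 1) div 2) then 2 else 1)"
      using pos(2)[OF conjunct2[OF i] conjunct1[OF i]] x by (rule iffD1)
    then show "x \<in> (\<lambda>i. 2 * i + (if s i then 2 else 1)) ` {..<r}"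
      by (rule image_eqI) (use i in simp)
  next
    fix x assume "x \<in> (\<lambda>i. 2 * i + (if s i then 2 else 1)) ` {..<r}"
    then obtain i where "i < r" "x = 2 * i + (if s i then 2 else 1)" by auto
    then show "x \<in> b" using pos(2)[of i x] by (auto split: if_splits)
  qed
  ultimately have "P = standard_clique r s 2"
    using b(1) V standard_edges_2[of r s] by (simp add: standard_clique_def mult.commute)
  moreover have "s 0" using a(2) by (simp add: s_def)
  ultimately show ?thesis using that by blast
qed

lemma alternating_pattern_standard: "alternating_pattern r = standard_clique r even 2"
proof -
  define w where "w = concat (map (\<lambda>i. if odd i then [A, B] else [B, A]) [1..<r + 1])"
  have len: "length w = 2 * r"
    and nth: "i < r \<Longrightarrow> w ! (2 * i) = (if even i then A else B) \<and> w ! Suc (2 * i) = (if even i then B else A)" for i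
  proof -
    have "length w = 2 * r \<and> (\<forall>i<r. w ! (2 * i) = (if even i then A else B) \<and> w ! Suc (2 * i) = (if even i then B else A))"
      unfolding w_def
    proof (induction r)
      case (Suc r)
      let ?u = "concat (map (\<lambda>i. if odd i then [A, B] else [B, A]) [1..<r + 1])"
      have "concat (map (\<lambda>i. if odd i then [A, B] else [B, A]) [1..<Suc r + 1])
          = ?u @ (if odd (Suc r) then [A, B] else [B, A])" by simp
      then show ?case using Suc by (auto simp: nth_append less_Suc_eq)
    qed simp
    then show "length w = 2 * r"
      "i < r \<Longrightarrow> w ! (2 * i) = (if even i then A else B) \<and> w ! Suc (2 * i) = (if even i then B else A)" by auto
  qed
  have pos: "{i \<in> {1..length w}. w ! (i - 1) = l} = (\<lambda>i. 2 * i + (if even i \<longleftrightarrow> l = A then 1 else 2)) ` {..<r}" for l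
  proof (intro equalityI subsetI)
    fix x assume "x \<in> {i \<in> {1..length w}. w ! (i - 1) = l}"
    then have x: "1 \<le> x" "x - 1 < 2 * r" "w ! (x - 1) = l" using len by auto
    define i where "i = (x - 1) div 2"
    have "i < r" "x - 1 = 2 * i \<or> x - 1 = Suc (2 * i)" using x unfolding i_def by auto
    then show "x \<in> (\<lambda>i. 2 * i + (if even i \<longleftrightarrow> l = A then 1 else 2)) ` {..<r}"
      using nth[of i] x by (intro image_eqI[of _ _ i]) (auto split: if_splits)
  next
    fix x assume "x \<in> (\<lambda>i. 2 * i + (if even i \<longleftrightarrow> l = A then 1 else 2)) ` {..<r}"
    then obtain i where "i < r" "x = 2 * i + (if even i \<longleftrightarrow> l = A then 1 else 2)" by auto
    then show "x \<in> {i \<in> {1..length w}. w ! (i - 1) = l}"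
      using nth[of i] len by (cases l) (auto split: if_splits)
  qed
  have pos_A: "{i \<in> {1..length w}. w ! (i - 1) = A} = (\<lambda>i. 2 * i + (if even i then 1 else 2)) ` {..<r}"
    using pos[of A] by simp
  have "(\<lambda>i. 2 * i + (if even i \<longleftrightarrow> B = A then 1 else 2)) ` {..<r} = (\<lambda>i. 2 * i + (if even i then 2 else 1)) ` {..<r}"
    by (intro image_cong) auto
  then have pos_B: "{i \<in> {1..length w}. w ! (i - 1) = B} = (\<lambda>i. 2 * i + (if even i then 2 else 1)) ` {..<r}"
    using pos[of B] by (simp only:)
  have "edges (alternating_pattern r) = standard_edge r even 2 ` {..<2}"
    unfolding alternating_pattern_def pattern_of_word_def w_def[symmetric] standard_edges_2
    by (simp only: ograph.simps pos_A pos_B)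
  moreover have "verts (alternating_pattern r) = {1..r * 2}"
    unfolding alternating_pattern_def pattern_of_word_def w_def[symmetric] by (simp add: len mult.commute)
  ultimately show ?thesis by (simp add: standard_clique_def)
qed

section \<open>The lower bound\<close>

text \<open>Opens room for \<open>m - 1\<close> further vertices in every block of \<open>f\<close> and puts the edge at the place
that the \<open>j\<close>-th edge of a clique has in this room.\<close>

definition stretch :: "nat \<Rightarrow> (nat \<Rightarrow> bool) \<Rightarrow> nat \<Rightarrow> nat \<Rightarrow> nat set \<Rightarrow> nat set" where
  "stretch r s m j f = (\<lambda>i. elt f i + i * (m - 1) + (if s i then j else m - 1 - j)) ` {..<r}"

definition last_edges :: "nat \<Rightarrow> (nat \<Rightarrow> bool) \<Rightarrow> nat \<Rightarrow> nat \<Rightarrow> nat set set" where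
  "last_edges r s m n = stretch r s m (m - 1) ` {f. f \<subseteq> {1..n - r * (m - 1)} \<and> card f = r}"

lemma stretch_mono:
  assumes "card f = r" "i < i'" "i' < r" "j < m"
  shows "elt f i + i * (m - 1) + (if s i then j else m - 1 - j)
       < elt f i' + i' * (m - 1) + (if s i' then j else m - 1 - j)"
proof -
  have "elt f i < elt f i'" using elt_mono assms by blast
  moreover have "i * (m - 1) + (if s i then j else m - 1 - j) \<le> Suc i * (m - 1)"
    using assms(4) by auto
  moreover have "Suc i * (m - 1) \<le> i' * (m - 1)" using assms(2) by (intro mult_right_mono) auto
  ultimately show ?thesis by linarith
qed

lemma elt_stretch:
  assumes "card f = r" "i < r" "j < m"
  shows "elt (stretch r s m j f) i = elt f i + i * (m - 1) + (if s i then j else m - 1 - j)"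
  unfolding stretch_def by (rule elt_of_strict_mono) (use assms stretch_mono in blast)+

lemma stretch_subset:
  assumes f: "f \<subseteq> {1..n - r * (m - 1)}" "card f = r" and "j < m"
  shows "stretch r s m j f \<subseteq> {1..n}" "card (stretch r s m j f) = r"
proof -
  show "card (stretch r s m j f) = r"
    unfolding stretch_def by (rule card_strict_mono_image) (use f assms(3) stretch_mono in blast)
  show "stretch r s m j f \<subseteq> {1..n}"
  proof
    fix x assume "x \<in> stretch r s m j f"
    then obtain i where i: "i < r" "x = elt f i + i * (m - 1) + (if s i then j else m - 1 - j)"
      unfolding stretch_def by auto
    have "finite f" using f(1) finite_subset by blast
    then have "elt f i \<in> f" using elt_mem i(1) f(2) by blast
    then have "1 \<le> elt f i" "elt f i \<le> n - r * (m - 1)" using f(1) by auto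
    moreover have "i * (m - 1) + (if s i then j else m - 1 - j) \<le> Suc i * (m - 1)"
      using assms(3) by auto
    moreover have "Suc i * (m - 1) \<le> r * (m - 1)" using i(1) by (intro mult_right_mono) auto
    moreover have "x = elt f i + (i * (m - 1) + (if s i then j else m - 1 - j))" using i(2) by simp
    ultimately have "1 \<le> x \<and> x \<le> n" by linarith
    then show "x \<in> {1..n}" by simp
  qed
qed

lemma card_last_edges:
  assumes "m \<ge> 1"
  shows "card (last_edges r s m n) = (n - r * (m - 1)) choose r"
proof -
  let ?X = "{f. f \<subseteq> {1..n - r * (m - 1)} \<and> card f = r}"
  have fin: "finite f" if "f \<in> ?X" for f using that finite_subset by blast
  have "inj_on (stretch r s m (m - 1)) ?X"
  proof (rule inj_onI)
    fix f g assume fg: "f \<in> ?X" "g \<in> ?X" and eq: "stretch r s m (m - 1) f = stretch r s m (m - 1) g"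
    have c: "card f = r" "card g = r" using fg by auto
    show "f = g"
    proof (rule elt_inject[OF fin[OF fg(1)] fin[OF fg(2)] c])
      fix i assume i: "i < r"
      have "m - 1 < m" using assms by simp
      then show "elt f i = elt g i"
        using elt_stretch[where s = s, OF c(1) i \<open>m - 1 < m\<close>]
          elt_stretch[where s = s, OF c(2) i \<open>m - 1 < m\<close>] eq by simp
    qed
  qed
  then show ?thesis unfolding last_edges_def using n_subsets[of "{1..n - r * (m - 1)}" r]
    by (simp add: card_image)
qed

lemma last_edges_subset: "m \<ge> 1 \<Longrightarrow> last_edges r s m n \<subseteq> {e. e \<subseteq> {1..n} \<and> card e = r}"
  unfolding last_edges_def using stretch_subset[of _ n r m "m - 1" s] by auto

text \<open>The gaps between the vertices of \<open>e\<close> are at least as large as the gaps between their ranks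
in the clique, and the rank of the \<open>i\<close>-th vertex is \<open>i * m\<close> or \<open>i * m + (m - 1)\<close>. Subtracting the
stretching therefore leaves a strictly increasing sequence of positive numbers, and the
vertices of the clique above \<open>e\<close> bound it from above.\<close>

lemma last_edge_of_clique:
  assumes K: "pattern_clique r s K" "card K = m" and sub: "\<And>e. e \<in> K \<Longrightarrow> e \<subseteq> {1..n}"
    and e: "e \<in> K" "index_in K e = m - 1" and "s 0" "m \<ge> 1"
  shows "e \<in> last_edges r s m n"
proof -
  let ?V = "\<Union>K"
  let ?\<rho> = "\<lambda>i. i * m + (if s i then m - 1 else 0)"
  let ?o = "\<lambda>i. i * (m - 1) + (if s i then m - 1 else 0)"
  have ce: "finite e" "card e = r" using K(1) e(1) by (auto simp: pattern_clique_def)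
  have V: "?V \<subseteq> {1..n}" "finite ?V" "card ?V = r * m"
    using sub K card_pattern_clique_Union[OF K(1) assms(6)] by (auto simp: pattern_clique_def)
  have below: "card {y \<in> ?V. y < elt e i} = ?\<rho> i" if "i < r" for i
    using rank_in_pattern_clique[OF K(1) e(1) that assms(6)] K(2) e(2) by (simp add: standard_position_def)
  have mem: "elt e i \<in> ?V" if "i < r" for i using elt_mem[OF ce(1)] ce(2) that e(1) by blast
  have lower: "?\<rho> i + 1 \<le> elt e i" if "i < r" for i
  proof -
    have "card {y \<in> ?V. y < elt e i} \<le> card {1..<elt e i}" using V(1) by (intro card_mono) auto
    moreover have "elt e i \<ge> 1" using mem[OF that] V(1) by fastforce
    ultimately show ?thesis using below[OF that] by simp
  qed
  have upper: "elt e i + r * m \<le> n + 1 + ?\<rho> i" if "i < r" for i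
  proof -
    have "card (?V - {y \<in> ?V. y < elt e i}) \<le> card {elt e i..n}" using V(1) by (intro card_mono) auto
    moreover have "card (?V - {y \<in> ?V. y < elt e i}) = r * m - ?\<rho> i"
      using V(2,3) below[OF that] by (subst card_Diff_subset) auto
    moreover have "?\<rho> i \<le> r * m" using below[OF that] V(2,3) by (metis (no_types, lifting) card_mono mem_Collect_eq subsetI)
    moreover have "elt e i \<le> n" using mem[OF that] V(1) by fastforce
    ultimately show ?thesis by simp
  qed
  have gap: "elt e i + ?\<rho> i' \<le> elt e i' + ?\<rho> i" if "i < i'" "i' < r" for i i'
  proof -
    have lt: "elt e i < elt e i'" using elt_mono that ce(2) by blast
    have "card {y \<in> ?V. y < elt e i'} \<le> card ({y \<in> ?V. y < elt e i} \<union> {elt e i..<elt e i'})"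
      using V(2) by (intro card_mono) auto
    also have "\<dots> \<le> card {y \<in> ?V. y < elt e i} + card {elt e i..<elt e i'}" by (rule card_Un_le)
    finally show ?thesis using below[of i] below[of i'] that lt by simp
  qed
  have \<rho>o: "?\<rho> i = ?o i + i" for i using assms(7) by (cases m) auto
  define x where "x i = elt e i - ?o i" for i
  have xo: "elt e i = x i + ?o i" if "i < r" for i
    using lower[OF that] \<rho>o[of i] unfolding x_def by linarith
  have x_mono: "x i < x i'" if "i < i'" "i' < r" for i i'
    using gap[OF that] xo[of i] xo[of i'] \<rho>o[of i] \<rho>o[of i'] that by linarith
  define f where "f = x ` {..<r}"
  have "card f = r" unfolding f_def by (rule card_strict_mono_image) (rule x_mono)
  have elt_f: "elt f i = x i" if "i < r" for i
    unfolding f_def by (rule elt_of_strict_mono) (use that x_mono in auto)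
  have "f \<subseteq> {1..n - r * (m - 1)}"
  proof
    fix y assume "y \<in> f"
    then obtain i where i: "i < r" "y = x i" by (auto simp: f_def)
    have "1 \<le> x i" using lower[OF i(1)] xo[OF i(1)] \<rho>o[of i] by linarith
    moreover have "r * m = r * (m - 1) + r" using assms(7) by (cases m) auto
    then have "x i + r * (m - 1) \<le> n" using upper[OF i(1)] xo[OF i(1)] \<rho>o[of i] i(1) by linarith
    ultimately show "y \<in> {1..n - r * (m - 1)}" using i(2) by simp
  qed
  moreover have "e = stretch r s m (m - 1) f"
  proof -
    have "e = elt e ` {..<r}" using elt_image[OF ce] by simp
    also have "\<dots> = stretch r s m (m - 1) f"
      unfolding stretch_def by (intro image_cong refl) (use elt_f xo in simp)
    finally show ?thesis .
  qed
  ultimately show ?thesis using \<open>card f = r\<close> unfolding last_edges_def by blast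
qed

lemma ex_less_standard_lower_bound:
  assumes "r \<ge> 1" "s 0" "m \<ge> 1"
  shows "(n choose r) \<le> ex_less r n (standard_clique r s m) + ((n - r * (m - 1)) choose r)"
proof -
  let ?U = "{e. e \<subseteq> {1..n} \<and> card e = r}"
  let ?F = "?U - last_edges r s m n"
  have "clique_free r s m ?F"
    unfolding clique_free_def
  proof
    assume "\<exists>K\<subseteq>?F. pattern_clique r s K \<and> card K = m"
    then obtain K where K: "K \<subseteq> ?F" "pattern_clique r s K" "m = card K" by blast
    have "m - 1 \<in> index_in K ` K"
      using index_in_bij[OF K(2) assms(2,1)] K(3) assms(3) by (simp add: bij_betw_def)
    then obtain e where e: "e \<in> K" "index_in K e = m - 1" by auto
    have "e \<in> last_edges r s m n"
      by (rule last_edge_of_clique[OF K(2) K(3)[symmetric] _ e assms(2,3)]) (use K(1) in auto)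
    then show False using e(1) K(1) by blast
  qed
  then have "card ?F \<le> ex_less r n (standard_clique r s m)"
    by (rule ex_less_standard_ge[where s = s, OF Diff_subset _ assms(1,2)])
  moreover have "card ?F = (n choose r) - card (last_edges r s m n)"
    using last_edges_subset[OF assms(3), of r s n] n_subsets[of "{1..n}" r]
    by (subst card_Diff_subset) (auto intro: finite_subset)
  ultimately show ?thesis using card_last_edges[OF assms(3), of r s n] by linarith
qed

section \<open>The alternating pattern\<close>

text \<open>Two edges have the same key if and only if they arise from each other by moving the vertices
with even index up and those with odd index down by the same number of steps.\<close>

definition line_key :: "nat \<Rightarrow> nat set \<Rightarrow> int list" where
  "line_key r e = map (\<lambda>i. int (elt e i) - (if even i then 1 else - 1) * int (elt e 0)) [0..<r]"

lemma line_keyD: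
  "line_key r e = line_key r f \<Longrightarrow> i < r \<Longrightarrow>
    int (elt e i) - (if even i then 1 else - 1) * int (elt e 0)
    = int (elt f i) - (if even i then 1 else - 1) * int (elt f 0)"
  unfolding line_key_def by (drule arg_cong[where f = "\<lambda>l. l ! i"]) simp

text \<open>Each inequality between neighbouring blocks follows from the order of the vertices within one
of the two edges: the two vertices in the blocks \<open>i\<close> and \<open>i + 1\<close> that are closest to each
other belong to the same edge.\<close>

lemma follows_alternating_pattern_on_line:
  assumes "line_key r e = line_key r f" "card e = r" "card f = r" "elt e 0 < elt f 0"
  shows "follows_pattern r even e f"
proof -
  note key = line_keyD[OF assms(1)]
  have less: "elt e i < elt f i \<longleftrightarrow> even i" "elt e i \<noteq> elt f i" if "i < r" for i
    using key[OF that] assms(4) by (auto split: if_splits)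
  moreover have "elt e i < elt f (Suc i) \<and> elt f i < elt e (Suc i)" if "Suc i < r" for i
    using less[of i] less[of "Suc i"] elt_mono[of i "Suc i" e] elt_mono[of i "Suc i" f] that assms(2,3)
    by (cases "even i") auto
  ultimately show ?thesis by (simp add: follows_pattern_def)
qed

text \<open>On every line the members of \<open>F\<close> are at most as many as the edges that are not among the
last edges. If the line contains a last edge, take the lowest one. It is the stretching
of some \<open>f\<close>, and the other \<open>m - 1\<close> stretchings of \<open>f\<close> lie below it on the same line.\<close>

lemma alternating_clique_free_le:
  fixes F :: "nat set set"
  assumes F: "F \<subseteq> {e. e \<subseteq> {1..n} \<and> card e = r}" and free: "clique_free r even m F" and "m \<ge> 1" "r \<ge> 1"
  shows "card F + ((n - r * (m - 1)) choose r) \<le> n choose r"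
proof -
  let ?U = "{e. e \<subseteq> {1..n} \<and> card e = r}"
  let ?D = "last_edges r even m n"
  have finU: "finite ?U" by simp
  have fin: "finite e" if "e \<in> ?U" for e using that finite_subset by blast
  have "card F \<le> card (?U - ?D)"
  proof (rule card_le_by_fibres[where h = "line_key r"])
    fix y
    let ?L = "{e \<in> ?U. line_key r e = y}"
    have inj: "inj_on (\<lambda>e. elt e 0) ?L"
    proof (rule inj_onI)
      fix e f assume ef: "e \<in> ?L" "f \<in> ?L" "elt e 0 = elt f 0"
      have "line_key r e = line_key r f" using ef by simp
      note key = line_keyD[OF this]
      have U: "e \<in> ?U" "f \<in> ?U" using ef by blast+
      then have c: "card e = r" "card f = r" by blast+
      show "e = f"
      proof (rule elt_inject[OF fin[OF U(1)] fin[OF U(2)] c])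
        fix i assume "i < r"
        then show "elt e i = elt f i" using key[of i] ef(3) by simp
      qed
    qed
    show "card {e \<in> F. line_key r e = y} \<le> card {e \<in> ?U - ?D. line_key r e = y}"
    proof (cases "?D \<inter> ?L = {}")
      case True
      then have "{e \<in> F. line_key r e = y} \<subseteq> {e \<in> ?U - ?D. line_key r e = y}" using F by blast
      then show ?thesis using finU by (intro card_mono) auto
    next
      case False
      have "card {e \<in> F. line_key r e = y} \<le> m - 1"
      proof (rule ccontr)
        assume "\<not> ?thesis"
        then have "m \<le> card {e \<in> F. line_key r e = y}" by simp
        then obtain K where K: "K \<subseteq> {e \<in> F. line_key r e = y}" "card K = m" "finite K"
          by (rule obtain_subset_with_card_n)
        have "pattern_clique r even K"
          unfolding pattern_clique_def
        proof (intro conjI ballI impI K(3))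
          fix e assume "e \<in> K"
          then have e: "e \<in> ?L" using K(1) F by blast
          then have eU: "e \<in> ?U" by blast
          then show "finite e" by (rule fin)
          show "card e = r" using eU by blast
          fix f assume "f \<in> K" "e \<noteq> f"
          then have f: "f \<in> ?L" using K(1) F by blast
          have "elt e 0 \<noteq> elt f 0" using inj_onD[OF inj _ e f] \<open>e \<noteq> f\<close> by blast
          moreover have "line_key r e = line_key r f" "line_key r f = line_key r e" "card e = r" "card f = r"
            using e f by auto
          ultimately show "follows_pattern r even e f \<or> follows_pattern r even f e"
            using follows_alternating_pattern_on_line by (metis linorder_neqE_nat)
        qed
        moreover have "K \<subseteq> F" using K(1) by blast
        ultimately show False using free K(2) unfolding clique_free_def by blast
      qed
      also have "m - 1 \<le> card {e \<in> ?U - ?D. line_key r e = y}"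
      proof -
        define e where "e = arg_min_on (\<lambda>e. elt e 0) (?D \<inter> ?L)"
        have fD: "finite (?D \<inter> ?L)" using finU by (rule finite_subset[rotated]) blast
        have eD: "e \<in> ?D \<inter> ?L" and least: "\<And>g. g \<in> ?D \<inter> ?L \<Longrightarrow> elt e 0 \<le> elt g 0"
          using arg_min_if_finite[OF fD False, of "\<lambda>e. elt e 0"] unfolding e_def by (auto simp: not_less)
        then obtain f where f: "e = stretch r even m (m - 1) f" "f \<subseteq> {1..n - r * (m - 1)}" "card f = r"
          unfolding last_edges_def by auto
        let ?e = "\<lambda>j. stretch r even m j f"
        have e0: "elt (?e j) 0 = elt f 0 + j" if "j < m" for j
          using elt_stretch[OF f(3) _ that, of 0 even] assms(4) by simp
        have key: "line_key r (?e j) = y" if j: "j < m" for j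
        proof -
          have "line_key r (?e j) = line_key r e"
            unfolding line_key_def
          proof (rule map_cong[OF refl])
            fix i assume "i \<in> set [0..<r]"
            then have i: "i < r" by simp
            have "m - 1 < m" using j by simp
            show "int (elt (?e j) i) - (if even i then 1 else - 1) * int (elt (?e j) 0)
              = int (elt e i) - (if even i then 1 else - 1) * int (elt e 0)"
              unfolding f(1) e0[OF j] e0[OF \<open>m - 1 < m\<close>] elt_stretch[OF f(3) i j]
                elt_stretch[OF f(3) i \<open>m - 1 < m\<close>]
              using j by auto
          qed
          then show ?thesis using eD by simp
        qed
        have "?e j \<in> {e \<in> ?U - ?D. line_key r e = y}" if j: "j < m - 1" for j
        proof -
          have "j < m" "m - 1 < m" using j by auto
          then have U: "?e j \<in> ?U" using stretch_subset[OF f(2,3) \<open>j < m\<close>] by auto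
          moreover have "?e j \<notin> ?D"
            using least[of "?e j"] U key[OF \<open>j < m\<close>] e0[OF \<open>j < m\<close>] e0[OF \<open>m - 1 < m\<close>] f(1) j by auto
          ultimately show ?thesis using key[OF \<open>j < m\<close>] by blast
        qed
        then have sub: "?e ` {..<m - 1} \<subseteq> {e \<in> ?U - ?D. line_key r e = y}" by blast
        have "inj_on ?e {..<m - 1}"
        proof (rule inj_onI)
          fix j j' assume jj: "j \<in> {..<m - 1}" "j' \<in> {..<m - 1}" and eq: "?e j = ?e j'"
          have "j < m" "j' < m" using jj by auto
          from e0[OF this(1)] e0[OF this(2)] arg_cong[OF eq, of "\<lambda>x. elt x 0"] show "j = j'" by linarith
        qed
        then have "card (?e ` {..<m - 1}) = m - 1" by (simp add: card_image)
        moreover have "finite {e \<in> ?U - ?D. line_key r e = y}" using finU by (rule finite_subset[rotated]) blast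
        from card_mono[OF this sub] calculation show ?thesis by linarith
      qed
      finally show ?thesis .
    qed
  qed (use finU F finite_subset in blast)+
  moreover have "card (?U - ?D) = card ?U - card ?D"
    using last_edges_subset[OF assms(3), of r even n] finU by (intro card_Diff_subset) (auto intro: finite_subset)
  moreover have "card ?D \<le> card ?U" by (intro card_mono finU last_edges_subset assms)
  moreover have "card ?U = n choose r" using n_subsets[of "{1..n}" r] by simp
  ultimately show ?thesis using card_last_edges[OF assms(3), of r even n] by linarith
qed

section \<open>Crossing and nesting edges of graphs\<close>

text \<open>A filling \<open>H\<close> of the quadrant is processed cell by cell. The cell \<open>(u, d)\<close> receives \<open>vflow\<close> from
\<open>(u, d - 1)\<close> and \<open>hflow\<close> from \<open>(u - 1, d)\<close>, cancels their common part and adds \<open>H u d\<close> to both.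
In terms of row insertion into a row of a tableau, \<open>vflow H u d\<close> is the multiplicity of the letter
\<open>u\<close> in the row before time \<open>d\<close>, \<open>hflow H u d\<close> is the number of inserted letters below \<open>u\<close> that
have not yet replaced a larger letter, and the cancelled part counts the copies of \<open>u\<close> that are
bumped into the next row.\<close>

function (sequential) vflow hflow :: "(nat \<Rightarrow> nat \<Rightarrow> nat) \<Rightarrow> nat \<Rightarrow> nat \<Rightarrow> nat" where
  "vflow H u 0 = 0"
| "vflow H u (Suc d) = vflow H u d - min (vflow H u d) (hflow H u d) + H u d"
| "hflow H 0 d = 0"
| "hflow H (Suc u) d = hflow H u d - min (vflow H u d) (hflow H u d) + H u d"
  by pat_completeness auto
termination
  by (relation "measure (case_sum (\<lambda>(H, u, d). u + d) (\<lambda>(H, u, d). u + d))") auto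

definition bumped :: "(nat \<Rightarrow> nat \<Rightarrow> nat) \<Rightarrow> nat \<Rightarrow> nat \<Rightarrow> nat" where
  "bumped H u d = min (vflow H u d) (hflow H u d)"

text \<open>One of the two remainders after the cancellation is zero, so that the entry of the cell
is the smaller one of the outgoing flows. Hence the outgoing flows and
the bumped number determine everything that enters the cell.\<close>

lemma local_rule_inverse:
  "H u d = min (vflow H u (Suc d)) (hflow H (Suc u) d)"
  "vflow H u d = vflow H u (Suc d) - H u d + bumped H u d"
  "hflow H u d = hflow H (Suc u) d - H u d + bumped H u d"
  by (auto simp: bumped_def min_def)

text \<open>The cells are undone in the reverse order, starting from the boundary \<open>u + d = n\<close>.\<close>

lemma filling_determined:
  assumes "\<And>u d. u + d < n \<Longrightarrow> bumped H u d = bumped H' u d"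
    and "\<And>u. u < n \<Longrightarrow> vflow H u (n - u) = vflow H' u (n - u)"
    and "\<And>d. d < n \<Longrightarrow> hflow H (n - d) d = hflow H' (n - d) d"
    and "u + d < n"
  shows "H u d = H' u d"
proof -
  have flows: "\<forall>u d. u + d = n - j \<longrightarrow> vflow H u d = vflow H' u d \<and> hflow H u d = hflow H' u d"
    if "j \<le> n" for j
    using that
  proof (induction j)
    case 0
    show ?case
    proof (intro allI impI conjI)
      fix u d assume s: "u + d = n - 0"
      show "vflow H u d = vflow H' u d"
      proof (cases "u < n")
        case True
        moreover have "d = n - u" using s by simp
        ultimately show ?thesis using assms(2) by simp
      next
        case False
        then have "d = 0" using s by simp
        then show ?thesis by simp
      qed
      show "hflow H u d = hflow H' u d"
      proof (cases "d < n")
        case True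
        moreover have "u = n - d" using s by simp
        ultimately show ?thesis using assms(3) by simp
      next
        case False
        then have "u = 0" using s by simp
        then show ?thesis by simp
      qed
    qed
  next
    case (Suc j)
    show ?case
    proof (intro allI impI)
      fix u d assume s: "u + d = n - Suc j"
      then have s': "u + Suc d = n - j" "Suc u + d = n - j" and lt: "u + d < n"
        using Suc.prems by auto
      have v: "vflow H u (Suc d) = vflow H' u (Suc d)"
        and h: "hflow H (Suc u) d = hflow H' (Suc u) d"
        using Suc.IH Suc.prems s' Suc_leD by blast+
      have H: "H u d = H' u d"
        by (subst (1 2) local_rule_inverse(1)) (simp only: v h)
      show "vflow H u d = vflow H' u d \<and> hflow H u d = hflow H' u d"
        using local_rule_inverse(2)[of H u d] local_rule_inverse(2)[of H' u d]
          local_rule_inverse(3)[of H u d] local_rule_inverse(3)[of H' u d]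
          v h H assms(1)[OF lt] by presburger
    qed
  qed
  have "Suc u + d = n - (n - Suc (u + d))" "u + Suc d = n - (n - Suc (u + d))"
    using assms(4) by auto
  then have "vflow H u (Suc d) = vflow H' u (Suc d)" "hflow H (Suc u) d = hflow H' (Suc u) d"
    using flows[of "n - Suc (u + d)"] diff_le_self by blast+
  then show ?thesis
    by (subst (1 2) local_rule_inverse(1)) (simp only:)
qed

text \<open>The position \<open>d'\<close> is the last one before \<open>d\<close> with a positive entry. That the flow stays
positive from there on is what makes the choice of the last position useful below.\<close>

lemma vflow_pos_source:
  assumes "vflow H u d > 0"
  obtains d' where "d' < d" "H u d' > 0" "\<And>d''. d' < d'' \<Longrightarrow> d'' < d \<Longrightarrow> H u d'' = 0"
    "\<And>d''. d' < d'' \<Longrightarrow> d'' \<le> d \<Longrightarrow> vflow H u d'' > 0"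
proof -
  have "\<exists>d'<d. H u d' > 0 \<and> (\<forall>d''. d' < d'' \<longrightarrow> d'' < d \<longrightarrow> H u d'' = 0)
        \<and> (\<forall>d''. d' < d'' \<longrightarrow> d'' \<le> d \<longrightarrow> vflow H u d'' > 0)"
    using assms
  proof (induction d)
    case (Suc d)
    show ?case
    proof (cases "H u d > 0")
      case True
      then show ?thesis using Suc.prems
        by (intro exI[of _ d]) (auto simp: less_Suc_eq le_Suc_eq)
    next
      case False
      then have "vflow H u d > 0" using Suc.prems by auto
      from Suc.IH[OF this] obtain d' where "d' < d" "H u d' > 0"
        "\<forall>d''. d' < d'' \<longrightarrow> d'' < d \<longrightarrow> H u d'' = 0"
        "\<forall>d''. d' < d'' \<longrightarrow> d'' \<le> d \<longrightarrow> vflow H u d'' > 0" by blast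
      then show ?thesis using False Suc.prems
        by (intro exI[of _ d']) (auto simp: less_Suc_eq le_Suc_eq simp del: vflow.simps)
    qed
  qed simp
  then show ?thesis using that by blast
qed

lemma hflow_pos_source:
  assumes "hflow H u d > 0" "a \<le> u" "hflow H a d = 0"
  shows "\<exists>u'. a \<le> u' \<and> u' < u \<and> H u' d > 0"
  using assms
proof (induction u)
  case (Suc u)
  show ?case
  proof (cases "H u d > 0 \<and> a \<le> u")
    case True
    then show ?thesis by auto
  next
    case False
    then have "a \<le> u" "hflow H u d > 0" using Suc.prems by (auto simp: le_Suc_eq)
    then show ?thesis using Suc by (auto intro: less_SucI)
  qed
qed simp

text \<open>The cell \<open>(u, d)\<close> stands for the edge between \<open>u\<close> and \<open>N - 1 - d\<close>, so that two cells in this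
relation are two edges that cross, provided that both left ends precede both right ends.\<close>

abbreviation north_west :: "nat \<times> nat \<Rightarrow> nat \<times> nat \<Rightarrow> bool" where
  "north_west \<equiv> \<lambda>(u, d) (u', d'). u' < u \<and> d < d'"

text \<open>A bumped cell \<open>(b, t)\<close> has a source \<open>(b, s)\<close> earlier in its row and a source to its left at time
\<open>t\<close>. The chain is built from its last cell backwards, where \<open>(b, s)\<close> replaces \<open>(b, t)\<close>, and the
extra cell comes from the source on the left of the last cell. All new cells stay to the left
of the first bumped cell and not beyond the last one in time, which preserves the condition
that separates left from right ends.\<close>

lemma bumped_chain_lengthen_aux:
  assumes "sorted_wrt north_west ((b, t) # ch)"
    and "\<forall>(u, d)\<in>set ((b, t) # ch). bumped H u d > 0 \<and> d \<le> c"
    and "s < t" "H b s > 0" 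
  shows "\<exists>ch'. length ch' = Suc (length ch) \<and> sorted_wrt north_west ((b, s) # ch') \<and>
           (\<forall>(u, d)\<in>set ch'. H u d > 0 \<and> t \<le> d \<and> d \<le> c)"
  using assms
proof (induction ch arbitrary: b t s)
  case Nil
  have "hflow H b t > 0" using Nil.prems(2) by (auto simp: bumped_def)
  from hflow_pos_source[OF this, of 0] obtain a where "a < b" "H a t > 0" by auto
  then show ?case using Nil.prems
    by (intro exI[of _ "[(a, t)]"]) auto
next
  \<comment> \<open>If the source \<open>(b', s')\<close> of the next cell is not earlier than \<open>t\<close>, it extends the chain. Otherwise
    the flow in row \<open>b'\<close> is still alive at time \<open>t\<close>, so that the horizontal flow is exhausted
    there and \<open>(b, t)\<close> draws on a source strictly between \<open>b'\<close> and \<open>b\<close>; this source replaces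
    \<open>(b', s')\<close>.\<close>
  case (Cons e ch)
  obtain b' t' where e: "e = (b', t')" by (cases e)
  have bb: "b' < b" and tt: "t < t'" using Cons.prems(1) e by auto
  have "vflow H b' t' > 0" using Cons.prems(2) e by (auto simp: bumped_def)
  then obtain s' where s': "s' < t'" "H b' s' > 0"
    and none: "\<And>d. s' < d \<Longrightarrow> d < t' \<Longrightarrow> H b' d = 0"
    and stay: "\<And>d. s' < d \<Longrightarrow> d \<le> t' \<Longrightarrow> vflow H b' d > 0"
    by (rule vflow_pos_source) blast
  from Cons.IH[of b' t' s'] Cons.prems(1,2) s' e obtain ch' where
    ch': "length ch' = Suc (length ch)" "sorted_wrt north_west ((b', s') # ch')"
      "\<forall>(u, d)\<in>set ch'. H u d > 0 \<and> t' \<le> d \<and> d \<le> c" by auto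
  show ?case
  proof (cases "t \<le> s'")
    case True
    have "t' \<le> c" using Cons.prems(2) e by auto
    then show ?thesis using True ch' s' bb tt Cons.prems(3)
      by (intro exI[of _ "(b', s') # ch'"]) fastforce
  next
    case False
    have "vflow H b' (Suc t) > 0" "H b' t = 0"
      using stay[of "Suc t"] none[of t] False tt by auto
    then have "hflow H (Suc b') t = 0" by (auto simp: min_def split: if_splits)
    moreover have "hflow H b t > 0" using Cons.prems(2) by (auto simp: bumped_def)
    ultimately have "\<exists>a\<ge>Suc b'. a < b \<and> H a t > 0"
      using hflow_pos_source[of H b t "Suc b'"] bb by auto
    then obtain a where a: "b' < a" "a < b" "H a t > 0" by (auto simp: Suc_le_eq)
    have "t \<le> c" using Cons.prems(2) by auto
    then show ?thesis using a ch' tt Cons.prems(3)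
      by (intro exI[of _ "(a, t) # ch'"]) fastforce
  qed
qed

text \<open>The last condition says that the smallest rectangle containing the chain fits into the
staircase, which means that every left end precedes every right end.\<close>

definition has_staircase_chain :: "nat \<Rightarrow> (nat \<times> nat) set \<Rightarrow> nat \<Rightarrow> bool" where
  "has_staircase_chain n F k \<longleftrightarrow> (\<exists>ch. length ch = k \<and> sorted_wrt north_west ch \<and> set ch \<subseteq> F \<and>
     (\<forall>(u, d)\<in>set ch. \<forall>(u', d')\<in>set ch. u + d' < n))"

lemma has_staircase_chain_mono:
  assumes "F \<subseteq> F'" "has_staircase_chain n F k"
  shows "has_staircase_chain n F' k"
proof -
  obtain ch where "length ch = k" "sorted_wrt north_west ch" "set ch \<subseteq> F"
     "\<forall>(u, d)\<in>set ch. \<forall>(u', d')\<in>set ch. u + d' < n"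
    using assms(2) unfolding has_staircase_chain_def by blast
  moreover have "set ch \<subseteq> F'" using \<open>set ch \<subseteq> F\<close> assms(1) by (rule order_trans)
  ultimately show ?thesis unfolding has_staircase_chain_def by blast
qed

definition staircase_support :: "nat \<Rightarrow> (nat \<Rightarrow> nat \<Rightarrow> nat) \<Rightarrow> (nat \<times> nat) set" where
  "staircase_support n H = {(u, d). u + d < n \<and> H u d > 0}"

lemma bumped_chain_lengthen:
  assumes "has_staircase_chain n (staircase_support n (bumped H)) (Suc k)"
  shows "has_staircase_chain n (staircase_support n H) (Suc (Suc k))"
proof -
  obtain ch0 where ch0: "length ch0 = Suc k" "sorted_wrt north_west ch0"
    "set ch0 \<subseteq> staircase_support n (bumped H)"
    "\<forall>(u, d)\<in>set ch0. \<forall>(u', d')\<in>set ch0. u + d' < n"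
    using assms unfolding has_staircase_chain_def by blast
  obtain x ch where "ch0 = x # ch" using ch0(1) by (cases ch0) auto
  moreover obtain b t where "x = (b, t)" by (cases x)
  ultimately have ch0_eq: "ch0 = (b, t) # ch" by simp
  have ch: "length ch = k" "sorted_wrt north_west ((b, t) # ch)"
    "set ((b, t) # ch) \<subseteq> staircase_support n (bumped H)"
    using ch0(1-3) unfolding ch0_eq by auto
  have sep: "u + d' < n" if "(u, d) \<in> set ((b, t) # ch)" "(u', d') \<in> set ((b, t) # ch)" for u d u' d'
    using bspec[OF ch0(4), of "(u, d)"] that unfolding ch0_eq by auto
  define c where "c = n - Suc b"
  have c: "bumped H u d > 0 \<and> d \<le> c \<and> b + c < n" if "(u, d) \<in> set ((b, t) # ch)" for u d
  proof -
    have "(u, d) \<in> staircase_support n (bumped H)" using that ch(3) by blast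
    then have "bumped H u d > 0" unfolding staircase_support_def by simp
    moreover have "b + d < n" using sep[of b t u d] that by simp
    ultimately show ?thesis unfolding c_def by auto
  qed
  have bt: "bumped H b t > 0" "b + c < n" using c[of b t] by auto
  then have "vflow H b t > 0" by (simp add: bumped_def)
  then obtain s where s: "s < t" "H b s > 0" by (rule vflow_pos_source) blast
  have "\<forall>(u, d)\<in>set ((b, t) # ch). bumped H u d > 0 \<and> d \<le> c" using c by blast
  from bumped_chain_lengthen_aux[OF ch(2) this s] obtain ch' where
    ch': "length ch' = Suc (length ch)" "sorted_wrt north_west ((b, s) # ch')"
      "\<forall>(u, d)\<in>set ch'. H u d > 0 \<and> t \<le> d \<and> d \<le> c" by blast
  have le: "u \<le> b \<and> d \<le> c \<and> H u d > 0" if mem: "(u, d) \<in> set ((b, s) # ch')" for u d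
  proof (cases "(u, d) = (b, s)")
    case True
    then show ?thesis using s c[of b t] by auto
  next
    case False
    then have "(u, d) \<in> set ch'" using mem by auto
    moreover from this have "north_west (b, s) (u, d)" using ch'(2) by (meson sorted_wrt.simps(2))
    ultimately show ?thesis using ch'(3) by auto
  qed
  have sep': "u + d' < n" if "(u, d) \<in> set ((b, s) # ch')" "(u', d') \<in> set ((b, s) # ch')"
    for u d u' d'
    using le[OF that(1)] le[OF that(2)] bt(2) by linarith
  have "set ((b, s) # ch') \<subseteq> staircase_support n H"
  proof
    fix x assume x: "x \<in> set ((b, s) # ch')"
    obtain u d where "x = (u, d)" by (cases x)
    then show "x \<in> staircase_support n H" using x le[of u d] sep'[of u d u d] unfolding staircase_support_def by blast
  qed
  moreover have "length ((b, s) # ch') = Suc (Suc k)" using ch'(1) ch(1) by simp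
  moreover have "\<forall>(u, d)\<in>set ((b, s) # ch'). \<forall>(u', d')\<in>set ((b, s) # ch'). u + d' < n"
    using sep' by blast
  ultimately show ?thesis unfolding has_staircase_chain_def
    using ch'(2) by blast
qed

lemma flow_le:
  assumes "\<And>u d. u + d < n \<Longrightarrow> H u d \<le> D" "u + d \<le> n"
  shows "vflow H u d \<le> d * D" "hflow H u d \<le> u * D"
proof -
  show "vflow H u d \<le> d * D"
    using assms(2)
  proof (induction d)
    case (Suc d)
    then show ?case using assms(1)[of u d] by (simp; linarith)
  qed simp
  show "hflow H u d \<le> u * D"
    using assms(2)
  proof (induction u)
    case (Suc u)
    then show ?case using assms(1)[of u d] by (simp; linarith)
  qed simp
qed

lemma iterate_le:
  assumes "\<And>u d. u + d < n \<Longrightarrow> H u d \<le> D" "u + d < n"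
  shows "(bumped ^^ i) H u d \<le> n ^ i * D"
  using assms(2)
proof (induction i arbitrary: u d)
  case (Suc i)
  have "vflow ((bumped ^^ i) H) u d \<le> d * (n ^ i * D)"
    by (rule flow_le(1)[of n]) (use Suc in auto)
  also have "\<dots> \<le> n * (n ^ i * D)" using Suc.prems by (intro mult_right_mono) auto
  finally have "bumped ((bumped ^^ i) H) u d \<le> n * (n ^ i * D)"
    by (simp only: bumped_def[of "(bumped ^^ i) H"] min.coboundedI1)
  then show ?case by (simp add: mult.assoc)
qed (use assms(1) in simp)

lemma iterate_flow_le:
  assumes "\<And>u d. u + d < n \<Longrightarrow> H u d \<le> D" "u + d \<le> n" "n > 0" "i \<le> k"
  shows "vflow ((bumped ^^ i) H) u d \<le> n ^ Suc k * D" "hflow ((bumped ^^ i) H) u d \<le> n ^ Suc k * D"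
proof -
  note le = flow_le[where H = "(bumped ^^ i) H" and D = "n ^ i * D", OF iterate_le[where H = H, OF assms(1)] assms(2)]
  have "n ^ i * D \<le> n ^ k * D" using assms(3,4) by (intro mult_right_mono power_increasing) auto
  then have mono: "j * (n ^ i * D) \<le> n ^ Suc k * D" if "j \<le> n" for j
    using mult_mono[OF that, of "n ^ i * D" "n ^ k * D"] by (simp add: mult.assoc)
  show "vflow ((bumped ^^ i) H) u d \<le> n ^ Suc k * D"
    using le(1) mono[of d] assms(2) by linarith
  show "hflow ((bumped ^^ i) H) u d \<le> n ^ Suc k * D"
    using le(2) mono[of u] assms(2) by linarith
qed

lemma chain_free_iterate_empty:
  assumes "\<not> has_staircase_chain n (staircase_support n H) (Suc k)"
  shows "staircase_support n ((bumped ^^ k) H) = {}"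
proof -
  have "\<not> has_staircase_chain n (staircase_support n ((bumped ^^ i) H)) (Suc (k - i))" if "i \<le> k" for i
    using that
  proof (induction i)
    case (Suc i)
    then have "Suc (k - i) = Suc (Suc (k - Suc i))" by simp
    then show ?case using Suc bumped_chain_lengthen[of n "(bumped ^^ i) H" "k - Suc i"] by auto
  qed (use assms in simp)
  from this[of k] have no: "\<not> has_staircase_chain n (staircase_support n ((bumped ^^ k) H)) 1" by simp
  show ?thesis
  proof (rule ccontr)
    assume "staircase_support n ((bumped ^^ k) H) \<noteq> {}"
    then obtain x where x: "x \<in> staircase_support n ((bumped ^^ k) H)" by blast
    then have "has_staircase_chain n (staircase_support n ((bumped ^^ k) H)) 1"
      unfolding has_staircase_chain_def by (intro exI[of _ "[x]"]) (auto simp: staircase_support_def)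
    then show False using no by simp
  qed
qed

lemma iterate_determined:
  assumes "\<And>u d. u + d < n \<Longrightarrow> (bumped ^^ k) H u d = (bumped ^^ k) H' u d"
    and "\<And>i u. i < k \<Longrightarrow> u < n \<Longrightarrow>
        vflow ((bumped ^^ i) H) u (n - u) = vflow ((bumped ^^ i) H') u (n - u)"
    and "\<And>i d. i < k \<Longrightarrow> d < n \<Longrightarrow>
        hflow ((bumped ^^ i) H) (n - d) d = hflow ((bumped ^^ i) H') (n - d) d"
    and "u + d < n"
  shows "H u d = H' u d"
proof -
  have "\<forall>u d. u + d < n \<longrightarrow> (bumped ^^ (k - j)) H u d = (bumped ^^ (k - j)) H' u d"
    if "j \<le> k" for j
    using that
  proof (induction j)
    case (Suc j)
    then have eq: "k - j = Suc (k - Suc j)" by simp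
    show ?case
    proof (intro allI impI)
      fix u d assume lt: "u + d < n"
      show "(bumped ^^ (k - Suc j)) H u d = (bumped ^^ (k - Suc j)) H' u d"
      proof (rule filling_determined[OF _ _ _ lt])
        fix u d assume "u + d < n"
        then show "bumped ((bumped ^^ (k - Suc j)) H) u d = bumped ((bumped ^^ (k - Suc j)) H') u d"
          using Suc eq by simp
      qed (use assms(2,3) Suc.prems in auto)
    qed
  qed (use assms(1) in simp)
  from this[of k] assms(4) show ?thesis by simp
qed

text \<open>The witness \<open>D = C ^ b\<close> makes the left side exceed the right side as soon as \<open>a > b\<close>.\<close>

lemma exponent_le_of_polynomial_bound:
  fixes a b C :: nat
  assumes "C \<ge> 1" and "\<And>D. (D + 1) ^ a \<le> (C * D + 1) ^ b"
  shows "a \<le> b"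
proof (rule ccontr)
  assume "\<not> a \<le> b"
  then have "Suc b \<le> a" by simp
  define D where "D = C ^ b"
  have "(D + 1) ^ Suc b \<le> (D + 1) ^ a" using \<open>Suc b \<le> a\<close> by (intro power_increasing) auto
  also have "\<dots> \<le> (C * D + 1) ^ b" by (rule assms(2))
  also have "\<dots> \<le> (C * (D + 1)) ^ b" using assms(1) by (intro power_mono) auto
  also have "\<dots> = D * (D + 1) ^ b" by (simp only: D_def power_mult_distrib)
  also have "\<dots> < (D + 1) ^ Suc b" by simp
  finally show False by simp
qed

text \<open>The \<open>(D + 1) ^ card F\<close> fillings of \<open>F\<close> with entries up to \<open>D\<close> are encoded injectively by the boundary flows
of the first \<open>k\<close> transformations, because the support of the \<open>k\<close>-th iterate is empty. These are
\<open>2 * k * n\<close> numbers, each bounded by a multiple of \<open>D\<close>.\<close>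

lemma card_chain_free_le:
  fixes F :: "(nat \<times> nat) set"
  assumes F: "F \<subseteq> {(u, d). u + d < n}" and no: "\<not> has_staircase_chain n F (Suc k)"
  shows "card F \<le> 2 * k * n"
proof (rule exponent_le_of_polynomial_bound)
  show "n ^ Suc k + 1 \<ge> 1" by simp
next
  fix D :: nat
  let ?b = "(n ^ Suc k + 1) * D"
  define I where "I = {..<k} \<times> {..<n} \<times> (UNIV :: bool set)"
  define fill where "fill h u d = (if (u, d) \<in> F then h (u, d) else (0::nat))" for h :: "nat \<times> nat \<Rightarrow> nat" and u d
  define code where "code h = restrict (\<lambda>(i, a, p).
      if p then vflow ((bumped ^^ i) (fill h)) a (n - a)
           else hflow ((bumped ^^ i) (fill h)) (n - a) a) I" for h
  have finF: "finite F"
    by (rule finite_subset[OF F], rule finite_subset[of _ "{..<n} \<times> {..<n}"]) auto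
  have inj: "inj_on code (F \<rightarrow>\<^sub>E {..D})"
  proof (rule inj_onI)
    fix h h' assume h: "h \<in> F \<rightarrow>\<^sub>E {..D}" "h' \<in> F \<rightarrow>\<^sub>E {..D}" and eq: "code h = code h'"
    have code: "code h x = code h' x" for x using eq by simp
    have "fill h u d = fill h' u d" if "u + d < n" for u d
    proof (rule iterate_determined[OF _ _ _ that])
      have "staircase_support n ((bumped ^^ k) (fill g)) = {}" for g
      proof (rule chain_free_iterate_empty)
        have "staircase_support n (fill g) \<subseteq> F" by (auto simp: staircase_support_def fill_def split: if_splits)
        then show "\<not> has_staircase_chain n (staircase_support n (fill g)) (Suc k)"
          using no has_staircase_chain_mono by blast
      qed
      then have "(bumped ^^ k) (fill g) u d = 0" if "u + d < n" for g u d
        using that unfolding staircase_support_def by (metis (mono_tags, lifting) case_prodI empty_iff gr0I mem_Collect_eq)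
      then show "(bumped ^^ k) (fill h) u d = (bumped ^^ k) (fill h') u d" if "u + d < n" for u d
        using that by simp
      show "vflow ((bumped ^^ i) (fill h)) u (n - u) = vflow ((bumped ^^ i) (fill h')) u (n - u)"
        if "i < k" "u < n" for i u
        using code[of "(i, u, True)"] that by (simp add: code_def I_def)
      show "hflow ((bumped ^^ i) (fill h)) (n - d) d = hflow ((bumped ^^ i) (fill h')) (n - d) d"
        if "i < k" "d < n" for i d
        using code[of "(i, d, False)"] that by (simp add: code_def I_def)
    qed
    then have agree: "fill h u d = fill h' u d" if "(u, d) \<in> F" for u d
      using F that by blast
    have "h x = h' x" if "x \<in> F" for x
      using agree[of "fst x" "snd x"] that by (simp add: fill_def)
    then show "h = h'" by (rule PiE_ext[OF h])
  qed
  have maps: "code ` (F \<rightarrow>\<^sub>E {..D}) \<subseteq> I \<rightarrow>\<^sub>E {..?b}"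
  proof (rule image_subsetI)
    fix h assume h: "h \<in> F \<rightarrow>\<^sub>E {..D}"
    have fill: "fill h u d \<le> D" for u d
    proof (cases "(u, d) \<in> F")
      case True
      then have "h (u, d) \<in> {..D}" using h by (rule PiE_mem[rotated])
      then show ?thesis by (simp add: fill_def)
    qed (simp add: fill_def)
    have "code h x \<le> ?b" if xI: "x \<in> I" for x
    proof -
      obtain i a p where x: "x = (i, a, p)" by (cases x)
      have ia: "i \<le> k" "n > 0" "a + (n - a) \<le> n" "n - a + a \<le> n"
        using xI by (auto simp: I_def x)
      have "code h x \<le> n ^ Suc k * D"
        using iterate_flow_le[where H = "fill h", OF fill ia(3,2,1)]
          iterate_flow_le[where H = "fill h", OF fill ia(4,2,1)] xI
        by (simp add: code_def x)
      then show ?thesis by (simp add: algebra_simps)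
    qed
    then show "code h \<in> I \<rightarrow>\<^sub>E {..?b}" by (auto simp: code_def)
  qed
  have "(D + 1) ^ card F = card (F \<rightarrow>\<^sub>E {..D})" using finF by (simp add: card_PiE)
  also have "\<dots> \<le> card (I \<rightarrow>\<^sub>E {..?b})"
    by (rule card_inj_on_le[OF inj maps]) (auto simp: I_def intro!: finite_PiE)
  also have "\<dots> = (?b + 1) ^ (2 * k * n)"
    by (simp add: card_PiE I_def card_cartesian_product ac_simps)
  finally show "(D + 1) ^ card F \<le> (?b + 1) ^ (2 * k * n)" .
qed

definition crossing :: "nat \<times> nat \<Rightarrow> nat \<times> nat \<Rightarrow> bool" where
  "crossing = (\<lambda>(u, v) (u', v'). u < u' \<and> u' < v \<and> v < v')"

definition nesting :: "nat \<times> nat \<Rightarrow> nat \<times> nat \<Rightarrow> bool" where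
  "nesting = (\<lambda>(u, v) (u', v'). u < u' \<and> u' < v' \<and> v' < v)"

lemma card_crossing_free_le:
  assumes F: "F \<subseteq> {(u, v). u < v \<and> v < N}"
    and no: "\<And>K. K \<subseteq> F \<Longrightarrow> card K = Suc k \<Longrightarrow> \<exists>x\<in>K. \<exists>y\<in>K. x \<noteq> y \<and> \<not> crossing x y \<and> \<not> crossing y x"
  shows "card F \<le> 2 * k * N"
proof -
  define \<phi> :: "nat \<times> nat \<Rightarrow> nat \<times> nat" where "\<phi> = (\<lambda>(u, v). (u, N - 1 - v))"
  have inj: "inj_on \<phi> F" 
  proof (rule inj_onI)
    fix x y assume "x \<in> F" "y \<in> F" "\<phi> x = \<phi> y"
    moreover obtain u v u' v' where "x = (u, v)" "y = (u', v')" by (cases x, cases y)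
    ultimately show "x = y" using subsetD[OF F, of x] subsetD[OF F, of y] by (auto simp: \<phi>_def)
  qed
  have "card (\<phi> ` F) \<le> 2 * k * (N - 1)"
  proof (rule card_chain_free_le)
    show "\<phi> ` F \<subseteq> {(u, d). u + d < N - 1}" using F by (fastforce simp: \<phi>_def)
    show "\<not> has_staircase_chain (N - 1) (\<phi> ` F) (Suc k)"
    proof
      assume "has_staircase_chain (N - 1) (\<phi> ` F) (Suc k)"
      then obtain ch where ch: "length ch = Suc k" "sorted_wrt north_west ch" "set ch \<subseteq> \<phi> ` F"
        and sep: "\<forall>(u, d)\<in>set ch. \<forall>(u', d')\<in>set ch. u + d' < N - 1"
        unfolding has_staircase_chain_def by blast
      define K where "K = {x \<in> F. \<phi> x \<in> set ch}"
      have K: "\<phi> ` K = set ch" "K \<subseteq> F" using ch(3) by (auto simp: K_def)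
      have "distinct ch"
        unfolding distinct_conv_nth
      proof (intro allI impI)
        fix i j assume "i < length ch" "j < length ch" "i \<noteq> j"
        then have "north_west (ch ! i) (ch ! j) \<or> north_west (ch ! j) (ch ! i)"
          using ch(2) by (metis nat_neq_iff sorted_wrt_nth_less)
        then show "ch ! i \<noteq> ch ! j" by (cases "ch ! i"; cases "ch ! j") auto
      qed
      then have "card (set ch) = Suc k" using ch(1) by (simp only: distinct_card)
      then have "card K = Suc k"
        using card_image[OF inj_on_subset[OF inj K(2)]] K(1) by (simp only:)
      from no[OF K(2) this] obtain x y where xy: "x \<in> K" "y \<in> K" "x \<noteq> y" "\<not> crossing x y" "\<not> crossing y x"
        by blast
      have "\<phi> x \<noteq> \<phi> y" using inj_onD[OF inj] xy K(2) by blast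
      moreover have "\<phi> x \<in> set ch" "\<phi> y \<in> set ch" using xy K by auto
      ultimately obtain i j where ij: "ch ! i = \<phi> x" "ch ! j = \<phi> y" "i < length ch" "j < length ch" "i \<noteq> j"
        by (metis in_set_conv_nth)
      obtain u v u' v' where eq: "x = (u, v)" "y = (u', v')" by (cases x, cases y)
      have uv: "u < v" "v < N" "u' < v'" "v' < N" using xy K(2) F eq by auto
      have "(u, N - 1 - v) \<in> set ch" "(u', N - 1 - v') \<in> set ch"
        using \<open>\<phi> x \<in> set ch\<close> \<open>\<phi> y \<in> set ch\<close> by (auto simp: \<phi>_def eq)
      then have "u + (N - 1 - v') < N - 1" "u' + (N - 1 - v) < N - 1"
        using bspec[OF bspec[OF sep, of "(u, N - 1 - v)", simplified case_prod_conv], of "(u', N - 1 - v')"]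
          bspec[OF bspec[OF sep, of "(u', N - 1 - v')", simplified case_prod_conv], of "(u, N - 1 - v)"]
        by simp_all
      then have "u < v'" "u' < v" using uv by auto
      moreover have "north_west (\<phi> x) (\<phi> y) \<or> north_west (\<phi> y) (\<phi> x)"
        using ij ch(2) by (metis nat_neq_iff sorted_wrt_nth_less)
      ultimately show False using xy(4,5) uv by (auto simp: eq \<phi>_def crossing_def)
    qed
  qed
  also have "\<dots> \<le> 2 * k * N" by simp
  finally show ?thesis using card_image[OF inj] by simp
qed

text \<open>Edges with the same sum of their end points nest pairwise, and there are fewer than \<open>2 * N\<close> sums.\<close>

lemma card_nesting_free_le:
  assumes F: "F \<subseteq> {(u, v). u < v \<and> v < N}"
    and no: "\<And>K. K \<subseteq> F \<Longrightarrow> card K = Suc k \<Longrightarrow> \<exists>x\<in>K. \<exists>y\<in>K. x \<noteq> y \<and> \<not> nesting x y \<and> \<not> nesting y x"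
  shows "card F \<le> 2 * k * N"
proof -
  have "finite F" by (rule finite_subset[OF F], rule finite_subset[of _ "{..<N} \<times> {..<N}"]) auto
  then have "card F \<le> (\<Sum>y\<in>{..<2 * N}. k)"
  proof (rule card_le_fibres[where h = "\<lambda>(u, v). u + v"])
    fix t
    show "card {x \<in> F. (case x of (u, v) \<Rightarrow> u + v) = t} \<le> k" (is "card ?L \<le> k")
    proof (rule ccontr)
      assume "\<not> card ?L \<le> k"
      then have "Suc k \<le> card ?L" by simp
      then obtain K where K: "K \<subseteq> ?L" "card K = Suc k" by (rule obtain_subset_with_card_n)
      have "K \<subseteq> F" using K(1) by blast
      from no[OF this K(2)] obtain x y
        where xy: "x \<in> K" "y \<in> K" "x \<noteq> y" "\<not> nesting x y" "\<not> nesting y x" by blast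
      obtain u v u' v' where eq: "x = (u, v)" "y = (u', v')" by (cases x, cases y)
      have "x \<in> ?L" "y \<in> ?L" using K(1) xy by auto
      then have "u < v" "u' < v'" "u + v = u' + v'" using F eq by auto
      then show False using xy by (auto simp: eq nesting_def)
    qed
  qed (use F in auto)
  then show ?thesis by (simp add: algebra_simps)
qed

section \<open>Lockstep families of edges\<close>

text \<open>The vertices other than \<open>i + 1\<close> depend on a single parameter \<open>t e\<close> and move in the directions of
their signs, so that for two edges the comparison in all these blocks is decided by block \<open>i\<close>.
Since the windows are shorter than the gaps, neighbouring blocks are separated, except possibly
the blocks \<open>i\<close> and \<open>i + 1\<close>. For those, following the pattern means that the pairs of vertices
\<open>i, i + 1\<close> cross, if the two signs agree, or nest, if they differ.\<close>

lemma lockstep_fibre_le: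
  fixes L :: "nat set set" and h :: "nat \<Rightarrow> int" and t :: "nat set \<Rightarrow> int"
  assumes L: "finite L" "\<And>e. e \<in> L \<Longrightarrow> finite e \<and> card e = r"
    and free: "clique_free r s (Suc k) L" and i: "Suc i < r"
    and move: "\<And>e j. e \<in> L \<Longrightarrow> j < r \<Longrightarrow> j \<noteq> Suc i \<Longrightarrow>
        int (elt e j) = h j + (if s j then 1 else - 1) * t e"
    and t: "\<And>e e'. e \<in> L \<Longrightarrow> e' \<in> L \<Longrightarrow> \<bar>t e - t e'\<bar> < int w"
    and near: "\<And>e. e \<in> L \<Longrightarrow> elt e (Suc i) < elt e i + 16 * w"
    and far: "\<And>e j. e \<in> L \<Longrightarrow> Suc j < r \<Longrightarrow> j \<noteq> i \<Longrightarrow> elt e j + 4 * w \<le> elt e (Suc j)"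
  shows "card L \<le> 34 * w * k"
proof (cases "L = {}")
  case False
  define lo where "lo = Min ((\<lambda>e. elt e i) ` L)"
  define \<pi> where "\<pi> e = (elt e i - lo, elt e (Suc i) - lo)" for e
  have lo: "lo \<le> elt e i" if "e \<in> L" for e
    unfolding lo_def by (rule Min_le) (use that L(1) in auto)
  have "lo \<in> (\<lambda>e. elt e i) ` L" unfolding lo_def by (rule Min_in) (use L(1) False in auto)
  then obtain e0 where e0: "e0 \<in> L" "lo = elt e0 i" by auto
  have ii: "i < r" "i \<noteq> Suc i" using i by auto
  have close: "\<bar>int (elt e j) - int (elt e' j)\<bar> < int w"
    if "e \<in> L" "e' \<in> L" "j < r" "j \<noteq> Suc i" for e e' j
    using move[OF that(1,3,4)] move[OF that(2,3,4)] t[OF that(1,2)] by (cases "s j") auto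
  have hi: "elt e i < lo + w" if "e \<in> L" for e
    using close[OF that e0(1) ii] e0(2) by linarith
  have incr: "elt e i < elt e (Suc i)" if "e \<in> L" for e
    using elt_mono[of i "Suc i" e] L(2)[OF that] i by simp
  have inj: "inj_on \<pi> L"
  proof (rule inj_onI)
    fix e e' assume e: "e \<in> L" "e' \<in> L" and eq: "\<pi> e = \<pi> e'"
    then have eqs: "elt e i = elt e' i" "elt e (Suc i) = elt e' (Suc i)"
      using lo[OF e(1)] lo[OF e(2)] incr[OF e(1)] incr[OF e(2)] by (auto simp: \<pi>_def)
    then have te: "t e = t e'"
      using move[OF e(1) ii] move[OF e(2) ii] by (auto split: if_splits)
    show "e = e'"
    proof (rule elt_inject)
      fix j assume "j < r"
      then show "elt e j = elt e' j"
        using eqs(2) te move[OF e(1), of j] move[OF e(2), of j] by (cases "j = Suc i") auto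
    qed (use L(2)[OF e(1)] L(2)[OF e(2)] in auto)
  qed
  have range: "\<pi> ` L \<subseteq> {(u, v). u < v \<and> v < 17 * w}"
  proof (rule image_subsetI)
    fix e assume e: "e \<in> L"
    show "\<pi> e \<in> {(u, v). u < v \<and> v < 17 * w}"
      using incr[OF e] near[OF e] lo[OF e] hi[OF e] by (auto simp: \<pi>_def)
  qed
  have pattern: "follows_pattern r s e e' \<or> follows_pattern r s e' e"
    if e: "e \<in> L" "e' \<in> L" and rel: "if s i = s (Suc i) then crossing (\<pi> e) (\<pi> e') else nesting (\<pi> e) (\<pi> e')"
    for e e'
  proof -
    have c: "elt e i < elt e' i" "elt e i < elt e' (Suc i)" "elt e' i < elt e (Suc i)"
      and c': "s i = s (Suc i) \<Longrightarrow> elt e (Suc i) < elt e' (Suc i)"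
        "s i \<noteq> s (Suc i) \<Longrightarrow> elt e' (Suc i) < elt e (Suc i)"
      using rel lo[OF e(1)] lo[OF e(2)] incr[OF e(1)] incr[OF e(2)]
      by (auto simp: crossing_def nesting_def \<pi>_def split: if_splits)
    have less: "elt e j \<noteq> elt e' j \<and> (elt e j < elt e' j \<longleftrightarrow> s j = s i)" if "j < r" for j
    proof (cases "j = Suc i")
      case True
      then show ?thesis using c' by (cases "s i = s (Suc i)") auto
    next
      case False
      show ?thesis
        using move[OF e(1) ii] move[OF e(2) ii] move[OF e(1) that False] move[OF e(2) that False] c(1)
        by (cases "s i"; cases "s j") auto
    qed
    have sep: "elt e j < elt e' (Suc j) \<and> elt e' j < elt e (Suc j)" if "Suc j < r" for j
    proof (cases "j = i")
      case False
      then show ?thesis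
        using far[OF e(1) that False] far[OF e(2) that False] close[OF e that] by linarith
    qed (use c in simp)
    show ?thesis
    proof (cases "s i")
      case True
      then show ?thesis using less sep by (simp add: follows_pattern_def)
    next
      case False
      have "elt e' j \<noteq> elt e j \<and> (elt e' j < elt e j \<longleftrightarrow> s j)" if "j < r" for j
        using less[OF that] False by (cases "s j") auto
      then show ?thesis using sep by (simp add: follows_pattern_def)
    qed
  qed
  have no: "\<exists>x\<in>K. \<exists>y\<in>K. x \<noteq> y \<and> \<not> R x y \<and> \<not> R y x"
    if K: "K \<subseteq> \<pi> ` L" "card K = Suc k" and R: "R = (if s i = s (Suc i) then crossing else nesting)" for K R
  proof (rule ccontr)
    assume "\<not> ?thesis"
    then have all: "R x y \<or> R y x" if "x \<in> K" "y \<in> K" "x \<noteq> y" for x y using that by blast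
    define K' where "K' = {e \<in> L. \<pi> e \<in> K}"
    have K': "K' \<subseteq> L" "\<pi> ` K' = K" using K(1) by (auto simp: K'_def)
    have "pattern_clique r s K'"
      unfolding pattern_clique_def
    proof (intro conjI ballI impI)
      show "finite K'" using K'(1) L(1) finite_subset by blast
      fix e assume "e \<in> K'"
      then have e: "e \<in> L" "\<pi> e \<in> K" by (auto simp: K'_def)
      then show "finite e" "card e = r" using L(2)[OF e(1)] by auto
      fix e' assume "e' \<in> K'" "e \<noteq> e'"
      then have e': "e' \<in> L" "\<pi> e' \<in> K" by (auto simp: K'_def)
      have "\<pi> e \<noteq> \<pi> e'" using inj_onD[OF inj _ e(1) e'(1)] \<open>e \<noteq> e'\<close> by blast
      from all[OF e(2) e'(2) this] show "follows_pattern r s e e' \<or> follows_pattern r s e' e"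
        using pattern[OF e(1) e'(1)] pattern[OF e'(1) e(1)] R
        by (cases "s i = s (Suc i)") auto
    qed
    moreover have "card K' = Suc k" using card_image[OF inj_on_subset[OF inj K'(1)]] K'(2) K(2) by simp
    ultimately show False using free K'(1) unfolding clique_free_def by blast
  qed
  have "card (\<pi> ` L) \<le> 2 * k * (17 * w)"
  proof (cases "s i = s (Suc i)")
    case True
    show ?thesis by (rule card_crossing_free_le[OF range no]) (use True in auto)
  next
    case False
    show ?thesis by (rule card_nesting_free_le[OF range no]) (use False in auto)
  qed
  then show ?thesis using card_image[OF inj] by (simp add: ac_simps)
qed simp

text \<open>The increasing enumeration of the natural numbers other than \<open>q\<close>.\<close>

definition skip :: "nat \<Rightarrow> nat \<Rightarrow> nat" where
  "skip q k = (if k < q then k else Suc k)"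

lemma skip_mono: "k < k' \<Longrightarrow> skip q k < skip q k'"
  by (simp add: skip_def)

lemma skip_less: "k < N \<Longrightarrow> skip q k < Suc N"
  by (simp add: skip_def)

lemma skip_surj: "j < Suc N \<Longrightarrow> j \<noteq> q \<Longrightarrow> q \<le> N \<Longrightarrow> \<exists>k<N. skip q k = j"
  by (intro exI[of _ "if j < q then j else j - 1"]) (auto simp: skip_def)

text \<open>Let \<open>y\<close> be the sequence of the vertices of \<open>e\<close> other than \<open>i + 1\<close>. Moving it in lockstep until the
vertex at \<open>p\<close> is a multiple of \<open>w\<close> yields a sequence \<open>x\<close>. Edges with the same \<open>x\<close> form a
lockstep family. The sequence \<open>x\<close> is determined by its values outside \<open>p\<close>, which
form an \<open>(r - 2)\<close>-set, and by the distance between its values at \<open>p\<close> and \<open>p + 1\<close> in units of \<open>w\<close>,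
because \<open>p\<close> carries a multiple of \<open>w\<close>. For \<open>a = 0\<close> nothing moves, and the gaps may be too small for
separation, but then vertex \<open>i + 1\<close> has fewer than \<open>16\<close> possible positions.\<close>

lemma class_le:
  fixes C :: "nat set set"
  assumes C: "C \<subseteq> {e. e \<subseteq> {1..n} \<and> card e = r}" and free: "clique_free r s (Suc k) C"
    and "Suc i < r" "p < r - 2" "k \<ge> 1" and w: "w = 2 ^ a"
    and near: "\<And>e. e \<in> C \<Longrightarrow> elt e (Suc i) < elt e i + 16 * w"
    and p_gap: "\<And>e. e \<in> C \<Longrightarrow> elt e (skip (Suc i) (Suc p)) < elt e (skip (Suc i) p) + 16 * w"
    and gap: "\<And>e j. e \<in> C \<Longrightarrow> a \<noteq> 0 \<Longrightarrow> j < r - 2 \<Longrightarrow>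
        elt e (skip (Suc i) j) + 8 * w \<le> elt e (skip (Suc i) (Suc j))"
    and far: "\<And>e j. e \<in> C \<Longrightarrow> a \<noteq> 0 \<Longrightarrow> Suc j < r \<Longrightarrow> j \<noteq> i \<Longrightarrow> elt e j + 4 * w \<le> elt e (Suc j)"
  shows "card C \<le> ((n + 2 * w) choose (r - 2)) * 18 * (34 * w * k)"
proof -
  define \<sigma> where "\<sigma> j = (if s j then 1 else - 1 :: int)" for j
  define y where "y e j = int (elt e (skip (Suc i) j))" for e j
  define t where "t e = \<sigma> (skip (Suc i) p) * (y e p mod int w)" for e
  define x where "x e j = y e j - \<sigma> (skip (Suc i) j) * t e" for e j
  \<comment> \<open>The shift by \<open>w\<close> compensates for values that the lockstep motion makes negative.\<close>
  define Z where "Z e = (\<lambda>j. nat (x e (skip p j) + int w)) ` {..<r - 2}" for e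
  define c where "c e = nat ((x e (Suc p) - x e p) div int w)" for e
  have w1: "w \<ge> 1" using w by simp
  have r3: "r \<ge> 3" using \<open>p < r - 2\<close> by simp
  have \<sigma>: "\<sigma> j = 1 \<or> \<sigma> j = - 1" for j by (simp add: \<sigma>_def)
  have C_card: "finite e \<and> card e = r" if "e \<in> C" for e using C that finite_subset by blast
  have finC: "finite C" using C by (rule finite_subset) simp
  have mod: "0 \<le> y e p mod int w" "y e p mod int w < int w" for e using w1 by auto
  have t_less: "\<bar>t e\<bar> < int w" for e using mod[of e] \<sigma>[of "skip (Suc i) p"] by (auto simp: t_def)
  have t0: "t e = 0" if "a = 0" for e using that w by (simp add: t_def)
  have skip_r: "skip (Suc i) j < r" if "j < r - 1" for j using skip_less[OF that, of "Suc i"] r3 by simp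
  have y_mono: "y e j < y e j'" if "e \<in> C" "j < j'" "j' < r - 1" for e j j'
    using elt_mono[of "skip (Suc i) j" "skip (Suc i) j'" e] skip_mono[OF that(2)] skip_r[OF that(3)]
      C_card[OF that(1)] by (simp add: y_def)
  have y_range: "1 \<le> y e j" "y e j \<le> int n" if "e \<in> C" "j < r - 1" for e j
  proof -
    have "elt e (skip (Suc i) j) \<in> e" using elt_mem skip_r[OF that(2)] C_card[OF that(1)] by blast
    then have "elt e (skip (Suc i) j) \<in> {1..n}" using C that(1) by blast
    then show "1 \<le> y e j" "y e j \<le> int n" by (auto simp: y_def)
  qed
  have xy: "\<bar>x e j - y e j\<bar> < int w" for e j
    using t_less[of e] \<sigma>[of "skip (Suc i) j"] by (auto simp: x_def)
  have x_p: "x e p = int w * (y e p div int w)" for e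
    using \<sigma>[of "skip (Suc i) p"] by (auto simp: x_def t_def minus_mod_eq_mult_div)
  have x_Suc: "x e j < x e (Suc j)" if e: "e \<in> C" and j: "j < r - 2" for e j
  proof (cases "a = 0")
    case True
    then show ?thesis using y_mono[OF e, of j "Suc j"] j t0 by (simp add: x_def)
  next
    case False
    have "y e j + 8 * int w \<le> y e (Suc j)" using gap[OF e False j] by (simp add: y_def)
    then show ?thesis using xy[of e j] xy[of e "Suc j"] w1 by linarith
  qed
  have x_mono: "x e j < x e j'" if e: "e \<in> C" and "j < j'" "j' < r - 1" for e j j'
    using that(2,3)
  proof (induction j')
    case (Suc j')
    then have "j' < r - 2" by simp
    then show ?case using Suc x_Suc[OF e, of j'] by (cases "j = j'") auto
  qed simp
  have x_range: "0 \<le> x e j + int w" "x e j + int w < int (n + 2 * w)" if "e \<in> C" "j < r - 1" for e j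
    using y_range[OF that] xy[of e j] by auto
  have sk: "skip p j < r - 1" if "j < r - 2" for j using skip_less[OF that, of p] r3 by simp
  have Z_mono: "nat (x e (skip p j) + int w) < nat (x e (skip p j') + int w)"
    if "e \<in> C" "j < j'" "j' < r - 2" for e j j'
    using x_mono[OF that(1) skip_mono[OF that(2)] sk[OF that(3)]] x_range(1)[OF that(1), of "skip p j"]
      sk[of j] that by simp
  have Z_card: "card (Z e) = r - 2" if "e \<in> C" for e
    unfolding Z_def by (rule card_strict_mono_image) (rule Z_mono[OF that])
  have elt_Z: "elt (Z e) j = nat (x e (skip p j) + int w)" if "e \<in> C" "j < r - 2" for e j
    unfolding Z_def by (rule elt_of_strict_mono) (use Z_mono[OF that(1)] that(2) in auto)
  have Z_sub: "Z e \<subseteq> {..<n + 2 * w}" if "e \<in> C" for e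
    unfolding Z_def
  proof (rule image_subsetI)
    fix j assume "j \<in> {..<r - 2}"
    then show "nat (x e (skip p j) + int w) \<in> {..<n + 2 * w}"
      using x_range[OF that sk[of j]] by auto
  qed
  \<comment> \<open>The gap at \<open>p\<close> is below \<open>16 * w\<close>, and each of its two ends moves by less than \<open>w\<close>.\<close>
  have c_less: "c e < 18" if e: "e \<in> C" for e
  proof -
    have "y e (Suc p) < y e p + 16 * int w" using p_gap[OF e] by (simp add: y_def)
    then have "x e (Suc p) - x e p < 18 * int w"
      using xy[of e p] xy[of e "Suc p"] by linarith
    moreover have "(x e (Suc p) - x e p) div int w * int w \<le> x e (Suc p) - x e p"
      using w1 by (simp add: minus_mod_eq_div_mult[symmetric])
    ultimately have "(x e (Suc p) - x e p) div int w * int w < 18 * int w" by linarith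
    then have "(x e (Suc p) - x e p) div int w < 18" using w1 by simp
    then show ?thesis unfolding c_def using nat_less_iff by (cases "0 \<le> (x e (Suc p) - x e p) div int w") auto
  qed
  have same_x: "x e j = x e' j"
    if e: "e \<in> C" "e' \<in> C" and eq: "Z e = Z e'" "c e = c e'" and j: "j < r - 1" for e e' j
  proof -
    have off: "x e j = x e' j" if "j < r - 1" "j \<noteq> p" for j
    proof -
      have "j < Suc (r - 2)" "p \<le> r - 2" using that(1) r3 \<open>p < r - 2\<close> by auto
      then obtain l where l: "l < r - 2" "skip p l = j" using skip_surj[of j "r - 2" p] \<open>j \<noteq> p\<close> by blast
      have "nat (x e j + int w) = nat (x e' j + int w)"
        using elt_Z[OF e(1) l(1)] elt_Z[OF e(2) l(1)] eq(1) l(2) by simp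
      then show ?thesis using x_range(1)[OF e(1) that(1)] x_range(1)[OF e(2) that(1)] by linarith
    qed
    have Sp: "Suc p < r - 1" using \<open>p < r - 2\<close> by simp
    have pos: "0 \<le> (x g (Suc p) - x g p) div int w" if "g \<in> C" for g
      using x_Suc[OF that \<open>p < r - 2\<close>] w1 by (simp add: pos_imp_zdiv_nonneg_iff)
    have "(x e (Suc p) - x e p) div int w = (x e' (Suc p) - x e' p) div int w"
      using eq(2) pos[OF e(1)] pos[OF e(2)] unfolding c_def by (simp add: nat_eq_iff)
    moreover have split: "(x g (Suc p) - x g p) div int w = x g (Suc p) div int w - y g p div int w" for g
    proof -
      have "(x g (Suc p) - x g p) div int w = (x g (Suc p) + int w * - (y g p div int w)) div int w"
        by (simp add: x_p)
      also have "\<dots> = - (y g p div int w) + x g (Suc p) div int w"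
        using w1 by (subst div_mult_self2) auto
      finally show ?thesis by simp
    qed
    ultimately have "x e (Suc p) div int w - y e p div int w = x e' (Suc p) div int w - y e' p div int w"
      by (simp only: split)
    then have "y e p div int w = y e' p div int w" using off[OF Sp] by simp
    then have "x e p = x e' p" by (simp add: x_p)
    then show ?thesis using off[OF j] by (cases "j = p") auto
  qed
  let ?T = "{Z. Z \<subseteq> {..<n + 2 * w} \<and> card Z = r - 2} \<times> {..<18::nat}"
  have "card C \<le> (\<Sum>y\<in>?T. 34 * w * k)"
  proof (rule card_le_fibres[where h = "\<lambda>e. (Z e, c e)"])
    show "finite ?T" by simp
    show "(Z e, c e) \<in> ?T" if "e \<in> C" for e using Z_sub[OF that] Z_card[OF that] c_less[OF that] by simp
    fix key assume "key \<in> ?T"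
    let ?L = "{e \<in> C. (Z e, c e) = key}"
    show "card ?L \<le> 34 * w * k"
    proof (cases "?L = {}")
      case False
      then obtain e0 where e0: "e0 \<in> ?L" by blast
      have L_C: "e \<in> C" if "e \<in> ?L" for e using that by simp
      have xe0: "x e j = x e0 j" if "e \<in> ?L" "j < r - 1" for e j
        using that e0 by (intro same_x) auto
      define h where "h j = x e0 (if j < Suc i then j else j - 1)" for j
      have move: "int (elt e j) = h j + (if s j then 1 else - 1) * t e"
        if "e \<in> ?L" "j < r" "j \<noteq> Suc i" for e j
      proof -
        let ?l = "if j < Suc i then j else j - 1"
        have l: "skip (Suc i) ?l = j" "?l < r - 1" using that(2,3) \<open>Suc i < r\<close> by (auto simp: skip_def)
        have "int (elt e j) = x e ?l + \<sigma> j * t e" using l(1) by (simp only: x_def y_def)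
        then show ?thesis using xe0[OF that(1) l(2)] by (simp add: h_def \<sigma>_def)
      qed
      show ?thesis
      proof (cases "a = 0")
        case True
        have el: "elt e j = elt e0 j" if "e \<in> ?L" "j < r" "j \<noteq> Suc i" for e j
          using move[OF that] move[OF e0 that(2,3)] t0[OF True] by simp
        have "inj_on (\<lambda>e. elt e (Suc i) - elt e0 i) ?L"
        proof (rule inj_onI)
          fix e e' assume e: "e \<in> ?L" "e' \<in> ?L" and eq: "elt e (Suc i) - elt e0 i = elt e' (Suc i) - elt e0 i"
          have *: "elt e0 i < elt g (Suc i)" if "g \<in> ?L" for g
            using el[OF that, of i] elt_mono[of i "Suc i" g] C_card[OF L_C[OF that]] \<open>Suc i < r\<close> by simp
          show "e = e'"
          proof (rule elt_inject)
            fix j assume "j < r"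
            show "elt e j = elt e' j"
            proof (cases "j = Suc i")
              case True
              then show ?thesis using eq *[OF e(1)] *[OF e(2)] by simp
            next
              case False
              then show ?thesis using el[OF e(1) \<open>j < r\<close>] el[OF e(2) \<open>j < r\<close>] by simp
            qed
          qed (use C_card[OF L_C[OF e(1)]] C_card[OF L_C[OF e(2)]] in auto)
        qed
        moreover have "(\<lambda>e. elt e (Suc i) - elt e0 i) ` ?L \<subseteq> {..<16}"
        proof (rule image_subsetI)
          fix e assume e: "e \<in> ?L"
          show "elt e (Suc i) - elt e0 i \<in> {..<16}"
            using near[OF L_C[OF e]] el[OF e, of i] \<open>Suc i < r\<close> True w by auto
        qed
        ultimately have "card ?L \<le> card {..<16::nat}" by (intro card_inj_on_le) auto
        moreover have "1 \<le> w * k" using w1 \<open>k \<ge> 1\<close> by simp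
        then have "card {..<16::nat} \<le> 34 * w * k" unfolding mult.assoc card_lessThan by linarith
        ultimately show ?thesis by linarith
      next
        case False
        show ?thesis
        proof (rule lockstep_fibre_le[where h = h and t = t and r = r and s = s and i = i])
          show "clique_free r s (Suc k) ?L" using free unfolding clique_free_def by blast
          show "\<bar>t e - t e'\<bar> < int w" if e: "e \<in> ?L" "e' \<in> ?L" for e e'
          proof -
            have "\<bar>y e p mod int w - y e' p mod int w\<bar> < int w" using mod[of e] mod[of e'] by linarith
            then show ?thesis using \<sigma>[of "skip (Suc i) p"] unfolding t_def by auto
          qed
        qed (use finC C_card near far[OF _ False] move \<open>Suc i < r\<close> in auto)
      qed
    next
      case True
      show ?thesis unfolding True by simp
    qed
  qed (use finC in auto)
  also have "\<dots> = ((n + 2 * w) choose (r - 2)) * 18 * (34 * w * k)"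
    using n_subsets[of "{..<n + 2 * w}" "r - 2"] by (simp add: card_cartesian_product)
  finally show ?thesis .
qed

text \<open>Take \<open>i\<close> at the smallest gap of \<open>e\<close> and \<open>p\<close> at the smallest gap after the removal of vertex \<open>i + 1\<close>.
The latter gap determines the scale \<open>a\<close>. The removed vertex merges two gaps, of which the second
is at least half of their sum, which explains the factor \<open>4\<close> in place of \<open>8\<close>. As \<open>r - 2\<close> gaps of
size at least \<open>8 * 2 ^ a\<close> fit into \<open>{1..n}\<close>, the scale is bounded.\<close>

lemma local_scale:
  fixes e :: "nat set"
  assumes e: "e \<subseteq> {1..n}" "card e = r" and r: "r \<ge> 3" and n: "8 * (r - 2) \<le> n"
  shows "\<exists>i p a. Suc i < r \<and> p < r - 2 \<and> 8 * 2 ^ a * (r - 2) \<le> n \<and>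
    elt e (Suc i) < elt e i + 16 * 2 ^ a \<and>
    elt e (skip (Suc i) (Suc p)) < elt e (skip (Suc i) p) + 16 * 2 ^ a \<and>
    (a \<noteq> 0 \<longrightarrow> (\<forall>j<r - 2. elt e (skip (Suc i) j) + 8 * 2 ^ a \<le> elt e (skip (Suc i) (Suc j))) \<and>
      (\<forall>j. Suc j < r \<longrightarrow> j \<noteq> i \<longrightarrow> elt e j + 4 * 2 ^ a \<le> elt e (Suc j)))"
proof -
  have fin: "finite e" using e(1) finite_subset by blast
  have mono: "elt e j < elt e j'" if "j < j'" "j' < r" for j j' using elt_mono that e(2) by blast
  define gap where "gap j = elt e (Suc j) - elt e j" for j
  have gap: "elt e (Suc j) = elt e j + gap j" "gap j > 0" if "Suc j < r" for j
    using mono[of j "Suc j"] that by (auto simp: gap_def)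
  have "\<exists>i. Suc i < r \<and> (\<forall>j. Suc j < r \<longrightarrow> gap i \<le> gap j)"
    by (rule ex_has_least_nat[of "\<lambda>j. Suc j < r" 0]) (use r in simp)
  then obtain i where i: "Suc i < r" and i_min: "\<And>j. Suc j < r \<Longrightarrow> gap i \<le> gap j" by blast
  define Y where "Y j = elt e (skip (Suc i) j)" for j
  define ygap where "ygap j = (if j < i then gap j else if j = i then gap i + gap (Suc i) else gap (Suc j))" for j
  have Y: "Y (Suc j) = Y j + ygap j" and ygap: "gap i \<le> ygap j" if "j < r - 2" for j
  proof -
    have "Suc j < r" "Suc (Suc j) < r" using that by auto
    then show "Y (Suc j) = Y j + ygap j" "gap i \<le> ygap j"
      using gap(1)[of j] gap(1)[of "Suc j"] i_min[of j] i_min[of "Suc j"]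
      by (auto simp: Y_def ygap_def skip_def)
  qed
  have "\<exists>p. p < r - 2 \<and> (\<forall>j. j < r - 2 \<longrightarrow> ygap p \<le> ygap j)"
    by (rule ex_has_least_nat[of "\<lambda>j. j < r - 2" 0]) (use r in simp)
  then obtain p where p: "p < r - 2" and p_min: "\<And>j. j < r - 2 \<Longrightarrow> ygap p \<le> ygap j" by blast
  define M where "M = max 1 (ygap p div 8)"
  have "\<exists>a. 2 ^ a \<le> M \<and> M < 2 ^ (a + 1)" by (rule ex_power_ivl1) (auto simp: M_def)
  then obtain a where a: "2 ^ a \<le> M" "M < 2 ^ (a + 1)" by blast
  have "ygap p div 8 < 2 * 2 ^ a" using a(2) unfolding M_def by simp
  then have p_less: "ygap p < 16 * 2 ^ a" by linarith
  have large: "8 * 2 ^ a \<le> ygap p" if "a \<noteq> 0"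
  proof -
    have "(2::nat) ^ 1 \<le> 2 ^ a" using that by (intro power_increasing) auto
    then have "M = ygap p div 8" using a(1) unfolding M_def by simp
    then show ?thesis using a(1) by simp
  qed
  have "8 * 2 ^ a * (r - 2) \<le> n"
  proof (cases "a = 0")
    case False
    have "1 + j * ygap p \<le> Y j" if "j \<le> r - 2" for j
      using that
    proof (induction j)
      case 0
      have "Y 0 \<in> e" unfolding Y_def using r e(2) fin by (intro elt_mem) (auto simp: skip_def)
      then show ?case using e(1) by auto
    next
      case (Suc j)
      then show ?case using Y[of j] p_min[of j] by simp
    qed
    from this[of "r - 2"] have "(r - 2) * ygap p < Y (r - 2)" by simp
    also have "Y (r - 2) \<in> e" unfolding Y_def using r e(2) fin by (intro elt_mem) (auto simp: skip_def)
    then have "Y (r - 2) \<le> n" using e(1) by auto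
    finally have "(r - 2) * ygap p \<le> n" by simp
    moreover have "8 * 2 ^ a * (r - 2) \<le> ygap p * (r - 2)" using large[OF False] by (rule mult_right_mono) simp
    ultimately show ?thesis using mult.commute[of "ygap p" "r - 2"] by linarith
  qed (use n in simp)
  moreover have "elt e (Suc i) < elt e i + 16 * 2 ^ a"
    using gap(1)[OF i] ygap[OF p] p_less by simp
  moreover have "elt e (skip (Suc i) (Suc p)) < elt e (skip (Suc i) p) + 16 * 2 ^ a"
    using Y[OF p] p_less by (simp add: Y_def)
  moreover have "elt e (skip (Suc i) j) + 8 * 2 ^ a \<le> elt e (skip (Suc i) (Suc j))" if "a \<noteq> 0" "j < r - 2" for j
    using Y[OF that(2)] p_min[OF that(2)] large[OF that(1)] by (simp add: Y_def)
  moreover have "elt e j + 4 * 2 ^ a \<le> elt e (Suc j)" if "a \<noteq> 0" "Suc j < r" "j \<noteq> i" for j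
  proof -
    have "j < i \<or> j = Suc i \<or> j > Suc i" using that(3) by linarith
    then consider "j < i" | "j = Suc i" | "j > Suc i" by blast
    then have "4 * 2 ^ a \<le> gap j"
    proof cases
      case 1
      then have "ygap j = gap j" "j < r - 2" using i by (auto simp: ygap_def)
      then show ?thesis using p_min[of j] large[OF that(1)] by simp
    next
      case 2
      then have "ygap i = gap i + gap j" "i < r - 2" using that(2) by (auto simp: ygap_def)
      then show ?thesis using p_min[of i] large[OF that(1)] i_min[OF that(2)] by simp
    next
      case 3
      then have "ygap (j - 1) = gap j" "j - 1 < r - 2" using that(2) by (auto simp: ygap_def)
      then show ?thesis using p_min[of "j - 1"] large[OF that(1)] by simp
    qed
    then show ?thesis using gap(1)[OF that(2)] by simp
  qed
  ultimately show ?thesis using i p by blast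
qed

section \<open>Summation over the dyadic scales\<close>

lemma sum_powers_le:
  assumes "M \<ge> 1"
  shows "(\<Sum>a\<in>{a. 2 ^ a \<le> M}. 2 ^ a) \<le> 2 * (M::nat)"
proof -
  obtain K where K: "2 ^ K \<le> M" "M < 2 ^ (K + 1)" using ex_power_ivl1[of 2 M] assms by auto
  have "{a. 2 ^ a \<le> M} = {..<Suc K}"
  proof (intro equalityI subsetI)
    fix a assume "a \<in> {a. 2 ^ a \<le> M}"
    then have "(2::nat) ^ a < 2 ^ (K + 1)" using K(2) by (auto intro: order.strict_trans1)
    then have "a < K + 1" by (rule power_less_imp_less_exp[rotated]) simp
    then show "a \<in> {..<Suc K}" by simp
  next
    fix a assume "a \<in> {..<Suc K}"
    then have "(2::nat) ^ a \<le> 2 ^ K" by (intro power_increasing) auto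
    then have "2 ^ a \<le> M" using K(1) by (rule order_trans)
    then show "a \<in> {a. 2 ^ a \<le> M}" by simp
  qed
  moreover have "(\<Sum>a<Suc K. 2 ^ a) = (2::nat) ^ Suc K - 1" by (induction K) auto
  ultimately show ?thesis using K by simp
qed

text \<open>Each factor of the product for the binomial coefficient grows at most by \<open>1 + 1 / q\<close>, and
\<open>(1 + 1 / q) ^ q\<close> is at most \<open>exp 1\<close>.\<close>

lemma choose_stretched_le:
  fixes n n' q :: nat
  assumes "q \<ge> 1" "8 * q \<le> n" "4 * q * n' \<le> 4 * q * n + n"
  shows "real (n' choose q) \<le> 3 * real (n choose q)"
proof (cases "q \<le> n'")
  case True
  have qn: "q \<le> n" using assms by simp
  have "real (n' choose q) = (\<Prod>i = 0..<q. real (n' - i) / real (q - i))"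
    by (rule binomial_altdef_of_nat[OF True])
  also have "\<dots> \<le> (\<Prod>i = 0..<q. (1 + 1 / real q) * (real (n - i) / real (q - i)))"
  proof (rule prod_mono)
    fix i assume i: "i \<in> {0..<q}"
    have "4 * real q * real n' \<le> 4 * real q * real n + real n"
      using of_nat_mono[OF assms(3), where 'a = real] by simp
    moreover have "real n \<le> 4 * real (n - i)" using i assms by auto
    ultimately have "4 * real q * real n' \<le> 4 * (real q * real n + real (n - i))" by (simp add: algebra_simps)
    then have "real q * real n' \<le> real q * real n + real (n - i)" by (simp only: mult.assoc) simp
    moreover have "real (n' - i) = real n' - real i" "real (n - i) = real n - real i"
      using i True qn by auto
    ultimately have "real q * real (n' - i) \<le> (real q + 1) * real (n - i)" by (simp add: algebra_simps)
    then have "real (n' - i) \<le> (1 + 1 / real q) * real (n - i)"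
      using assms(1) by (simp add: field_simps)
    then have "real (n' - i) / real (q - i) \<le> (1 + 1 / real q) * real (n - i) / real (q - i)"
      by (rule divide_right_mono) simp
    then show "0 \<le> real (n' - i) / real (q - i) \<and>
        real (n' - i) / real (q - i) \<le> (1 + 1 / real q) * (real (n - i) / real (q - i))" by simp
  qed
  also have "\<dots> = (1 + 1 / real q) ^ q * real (n choose q)"
    by (simp only: prod.distrib binomial_altdef_of_nat[OF qn]) simp
  also have "(1 + 1 / real q) ^ q \<le> exp (1 / real q) ^ q"
    by (intro power_mono exp_ge_add_one_self) simp
  also have "exp (1 / real q) ^ q = exp 1" using assms(1) by (simp add: exp_of_nat_mult[symmetric])
  also have "exp 1 \<le> (3::real)" by (rule exp_le)
  finally show ?thesis by (simp add: mult_right_mono)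
next
  case False
  then show ?thesis by (simp add: binomial_eq_0)
qed

lemma choose_Suc_real:
  assumes "q \<le> n"
  shows "(real q + 1) * real (n choose Suc q) = (real n - real q) * real (n choose q)"
proof -
  have "Suc q * (n choose Suc q) = (n - q) * (n choose q)"
    using binomial_absorption[of q n] binomial_absorb_comp[of n q] by simp
  then have "real (Suc q * (n choose Suc q)) = real ((n - q) * (n choose q))" by simp
  then show ?thesis using assms by (simp add: algebra_simps)
qed

text \<open>The edges are sorted by the positions \<open>i\<close> and \<open>p\<close> and the scale \<open>a\<close> of \<open>local_scale\<close>. The set \<open>A\<close> consists
of the possible scales. The sum of \<open>2 ^ a\<close> over \<open>A\<close> is at most twice its last term, hence at most
\<open>n / (4 * q)\<close>, and the lockstep motion enlarges the ground set only by the same amount.\<close>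

lemma clique_free_le:
  fixes F :: "nat set set"
  assumes F: "F \<subseteq> {e. e \<subseteq> {1..n} \<and> card e = r}" and free: "clique_free r s (Suc k) F"
    and r: "r \<ge> 3" and k: "k \<ge> 1" and n: "8 * r \<le> n"
  shows "real (card F) \<le> 918 * (real r ^ 2 * real k * real (n choose (r - 1)))"
proof -
  define q where "q = r - 2"
  have q: "q \<ge> 1" "8 * q \<le> n" "r = q + 2" "r - 1 = Suc q" using r n by (auto simp: q_def)
  define A where "A = {a. 2 ^ a \<le> n div (8 * q)}"
  have A: "8 * 2 ^ a * q \<le> n \<longleftrightarrow> a \<in> A" for a
    using q(1) less_eq_div_iff_mult_less_eq[of "8 * q" "2 ^ a" n] by (simp add: A_def ac_simps)
  have finA: "finite A"
  proof (rule finite_subset)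
    show "A \<subseteq> {..n}"
    proof
      fix a assume "a \<in> A"
      then have "2 ^ a \<le> n" unfolding A_def using div_le_dividend order_trans by blast
      moreover have "a < 2 ^ a" by (rule less_exp)
      ultimately have "a \<le> n" by linarith
      then show "a \<in> {..n}" by simp
    qed
  qed simp
  define Q where "Q e i p a \<longleftrightarrow> elt e (Suc i) < elt e i + 16 * 2 ^ a \<and>
    elt e (skip (Suc i) (Suc p)) < elt e (skip (Suc i) p) + 16 * 2 ^ a \<and>
    (a \<noteq> 0 \<longrightarrow> (\<forall>j<r - 2. elt e (skip (Suc i) j) + 8 * 2 ^ a \<le> elt e (skip (Suc i) (Suc j))) \<and>
      (\<forall>j. Suc j < r \<longrightarrow> j \<noteq> i \<longrightarrow> elt e j + 4 * 2 ^ a \<le> elt e (Suc j)))" for e :: "nat set" and i p a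
  let ?T = "{..<r - 1} \<times> {..<r - 2} \<times> A"
  have "\<exists>x. x \<in> ?T \<and> (case x of (i, p, a) \<Rightarrow> Q e i p a)" if e: "e \<in> F" for e
  proof -
    have "e \<subseteq> {1..n}" "card e = r" using F e by auto
    from local_scale[OF this r] obtain i p a where
      "Suc i < r" "p < r - 2" "8 * 2 ^ a * (r - 2) \<le> n" "Q e i p a"
      unfolding Q_def using q(2) by (auto simp: q_def)
    then have "(i, p, a) \<in> ?T \<and> (case (i, p, a) of (i, p, a) \<Rightarrow> Q e i p a)"
      using A[of a] by (auto simp: q_def)
    then show ?thesis by blast
  qed
  then obtain \<tau> where \<tau>: "\<And>e. e \<in> F \<Longrightarrow> \<tau> e \<in> ?T \<and> (case \<tau> e of (i, p, a) \<Rightarrow> Q e i p a)"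
    by metis
  define n' where "n' = n + n div (4 * q)"
  define c where "c = (n' choose q) * 18 * (34 * k)"
  have finF: "finite F" using F by (rule finite_subset) simp
  have "card F \<le> (\<Sum>x\<in>?T. c * 2 ^ snd (snd x))"
  proof (rule card_le_fibres[where h = \<tau>])
    fix x assume x: "x \<in> ?T"
    obtain i p a where xe: "x = (i, p, a)" by (cases x)
    have ipa: "Suc i < r" "p < r - 2" "a \<in> A" using x xe by auto
    let ?C = "{e \<in> F. \<tau> e = x}"
    have Q: "Q e i p a" if "e \<in> ?C" for e using \<tau>[of e] that xe by auto
    have "card ?C \<le> ((n + 2 * 2 ^ a) choose (r - 2)) * 18 * (34 * 2 ^ a * k)"
    proof (rule class_le[where s = s and i = i and p = p and a = a])
      show "clique_free r s (Suc k) ?C" using free unfolding clique_free_def by blast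
    qed (use F ipa k Q in \<open>auto simp: Q_def\<close>)
    also have "\<dots> \<le> (n' choose q) * 18 * (34 * 2 ^ a * k)"
    proof -
      have "8 * 2 ^ a * q \<le> n" using A ipa(3) by blast
      then have "2 * 2 ^ a \<le> n div (4 * q)"
        using q(1) less_eq_div_iff_mult_less_eq[of "4 * q" "2 * 2 ^ a" n] by (simp add: ac_simps)
      then have "(n + 2 * 2 ^ a) choose (r - 2) \<le> n' choose q"
        unfolding q_def n'_def by (intro binomial_right_mono) simp
      then show ?thesis by (intro mult_le_mono1)
    qed
    also have "\<dots> = c * 2 ^ snd (snd x)" by (simp add: c_def xe)
    finally show "card ?C \<le> c * 2 ^ snd (snd x)" .
  qed (use finA finF \<tau> in auto)
  also have "\<dots> = c * ((r - 1) * (r - 2) * (\<Sum>a\<in>A. 2 ^ a))"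
  proof -
    have "(\<Sum>x\<in>?T. c * 2 ^ snd (snd x)) = (\<Sum>i<r - 1. \<Sum>p<r - 2. \<Sum>a\<in>A. c * 2 ^ a)"
      by (simp only: sum.cartesian_product) (intro sum.cong refl; auto)
    then show ?thesis by (simp add: sum_distrib_left[symmetric] ac_simps)
  qed
  also have "\<dots> \<le> c * ((r - 1) * (r - 2) * (2 * (n div (8 * q))))"
  proof -
    have "1 \<le> n div (8 * q)" using q less_eq_div_iff_mult_less_eq[of "8 * q" 1 n] by simp
    from sum_powers_le[OF this] show ?thesis unfolding A_def by (intro mult_le_mono2)
  qed
  finally have "real (card F) \<le> real (c * ((r - 1) * (r - 2) * (2 * (n div (8 * q)))))"
    by (rule of_nat_mono)
  also have "\<dots> = real c * (real q + 1) * (real q * 2 * real (n div (8 * q)))"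
    using q(3) by (simp add: algebra_simps)
  also have "\<dots> \<le> real c * (real q + 1) * (real n / 4)"
  proof -
    have "8 * q * (n div (8 * q)) \<le> n" by simp
    then have "real (8 * q * (n div (8 * q))) \<le> real n" by (rule of_nat_mono)
    then have "real q * 2 * real (n div (8 * q)) \<le> real n / 4" by simp
    then show ?thesis by (intro mult_left_mono) auto
  qed
  also have "\<dots> = 153 * real k * (real q + 1) * (real n * real (n' choose q))" by (simp add: c_def)
  also have "\<dots> \<le> 153 * real k * (real q + 1) * (6 * (real q + 1) * real (n choose Suc q))"
  proof -
    have "4 * q * (n div (4 * q)) \<le> n" by simp
    then have "4 * q * n' \<le> 4 * q * n + n" by (simp add: n'_def algebra_simps)
    from choose_stretched_le[OF q(1,2) this]
    have "real n * real (n' choose q) \<le> real n * (3 * real (n choose q))" by (intro mult_left_mono) auto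
    also have "\<dots> \<le> 6 * ((real n - real q) * real (n choose q))"
    proof -
      have "real (8 * q) \<le> real n" using q(2) by (rule of_nat_mono)
      then have "real n \<le> 2 * (real n - real q)" by simp
      then have "real n * real (n choose q) \<le> 2 * (real n - real q) * real (n choose q)"
        by (intro mult_right_mono) auto
      then show ?thesis by (simp add: algebra_simps)
    qed
    also have "\<dots> = 6 * (real q + 1) * real (n choose Suc q)"
      using q(2) by (simp only: mult.assoc choose_Suc_real[of q n])
    finally show ?thesis by (intro mult_left_mono) auto
  qed
  also have "\<dots> = 918 * ((real q + 1) ^ 2 * real k * real (n choose (r - 1)))"
    unfolding q(4) by (simp add: power2_eq_square algebra_simps)
  also have "\<dots> \<le> 918 * (real r ^ 2 * real k * real (n choose (r - 1)))"
    unfolding q(3) by (intro mult_left_mono mult_right_mono power_mono) auto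
  finally show ?thesis .
qed

lemma clique_free_le_1:
  fixes F :: "nat set set"
  assumes F: "F \<subseteq> {e. e \<subseteq> {1..n} \<and> card e = 1}" and free: "clique_free 1 s (Suc k) F" and "s 0"
  shows "card F \<le> k"
proof (rule ccontr)
  assume "\<not> card F \<le> k"
  then have "Suc k \<le> card F" by simp
  then obtain K where K: "K \<subseteq> F" "card K = Suc k" "finite K" by (rule obtain_subset_with_card_n)
  have c: "finite e \<and> card e = 1" if "e \<in> K" for e
  proof -
    have "card e = 1" using that K(1) F by auto
    then show ?thesis by (simp add: card_ge_0_finite)
  qed
  have "pattern_clique 1 s K"
    unfolding pattern_clique_def
  proof (intro conjI ballI impI K(3))
    fix e assume e: "e \<in> K"
    then show "finite e" "card e = 1" using c by auto
    fix f assume f: "f \<in> K" "e \<noteq> f"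
    have "elt e 0 \<noteq> elt f 0"
      using elt_inject[of e f 1] c[OF e] c[OF f(1)] f(2) by auto
    then show "follows_pattern 1 s e f \<or> follows_pattern 1 s f e"
      using \<open>s 0\<close> by (auto simp: follows_pattern_def)
  qed
  then show False using free K unfolding clique_free_def by blast
qed

text \<open>For \<open>r = 2\<close> there is no further gap that could limit a lockstep motion, so that all edges form a single
lockstep family with a window of length \<open>n\<close>.\<close>

lemma clique_free_le_2:
  fixes F :: "nat set set"
  assumes F: "F \<subseteq> {e. e \<subseteq> {1..n} \<and> card e = 2}" and free: "clique_free 2 s (Suc k) F" and "s 0"
  shows "card F \<le> 34 * n * k"
proof (rule lockstep_fibre_le[where i = 0 and h = "\<lambda>_. 0" and r = 2 and s = s
      and t = "\<lambda>e. int (elt e 0)"])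
  have range: "1 \<le> elt e j \<and> elt e j \<le> n" if "e \<in> F" "j < 2" for e j
  proof -
    have "e \<subseteq> {1..n}" "card e = 2" using that(1) F by auto
    moreover from this have "finite e" using finite_subset by blast
    ultimately have "elt e j \<in> {1..n}" using elt_mem[of e j] that(2) by auto
    then show ?thesis by simp
  qed
  show "finite F" using F by (rule finite_subset) simp
  show "finite e \<and> card e = 2" if "e \<in> F" for e using that F finite_subset by blast
  show "clique_free 2 s (Suc k) F" by (rule free)
  show "int (elt e j) = 0 + (if s j then 1 else - 1) * int (elt e 0)"
    if "e \<in> F" "j < 2" "j \<noteq> Suc 0" for e j
    using that(2,3) \<open>s 0\<close> by (cases j) auto
  show "\<bar>int (elt e 0) - int (elt e' 0)\<bar> < int n" if "e \<in> F" "e' \<in> F" for e e'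
    using range[OF that(1), of 0] range[OF that(2), of 0] by auto
  show "elt e (Suc 0) < elt e 0 + 16 * n" if "e \<in> F" for e
    using range[OF that, of 0] range[OF that, of 1] by auto
qed auto

lemma ex_less_standard_upper_bound:
  assumes r: "r \<ge> 1" and "s 0" and m: "m \<ge> 1" and n: "8 * r \<le> n"
  shows "real (ex_less r n (standard_clique r s m))
    \<le> 918 * (real r ^ 2 * (real m - 1) * real (n choose (r - 1)))"
proof -
  obtain k where k: "m = Suc k" using m by (cases m) auto
  let ?b = "918 * (real r ^ 2 * real k * real (n choose (r - 1)))"
  have "card F \<le> nat \<lfloor>?b\<rfloor>"
    if F: "F \<subseteq> {e. e \<subseteq> {1..n} \<and> card e = r}" and free: "clique_free r s m F" for F :: "nat set set"
  proof -
    have free': "clique_free r s (Suc k) F" using free k by simp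
    have "real (card F) \<le> ?b"
    proof (cases "k = 0")
      case True
      have "F = {}"
      proof (rule ccontr)
        assume "F \<noteq> {}"
        then obtain e where e: "e \<in> F" by blast
        then have "finite e" "card e = r" using F finite_subset by blast+
        then have "pattern_clique r s {e}" by (simp add: pattern_clique_def)
        then show False using free' e True unfolding clique_free_def by (auto dest: spec[of _ "{e}"])
      qed
      then show ?thesis by simp
    next
      case False
      consider "r = 1" | "r = 2" | "r \<ge> 3" using r by linarith
      then show ?thesis
      proof cases
        case 1
        then show ?thesis using clique_free_le_1[of F n s k] F free' \<open>s 0\<close> by simp
      next
        case 2
        then have "card F \<le> 34 * n * k" using clique_free_le_2[of F n s k] F free' \<open>s 0\<close> by simp
        then have "real (card F) \<le> real (34 * n * k)" by (rule of_nat_mono)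
        also have "\<dots> \<le> ?b" using 2 by (simp add: mult_right_mono)
        finally show ?thesis .
      next
        case 3
        then show ?thesis using clique_free_le[OF F free' _ _ n] False by simp
      qed
    qed
    then show ?thesis by linarith
  qed
  from ex_less_standard_le[where s = s, OF this r \<open>s 0\<close> m]
  have "ex_less r n (standard_clique r s m) \<le> nat \<lfloor>?b\<rfloor>" .
  moreover have "0 \<le> ?b" by simp
  ultimately have "real (ex_less r n (standard_clique r s m)) \<le> ?b" by linarith
  then show ?thesis by (simp add: k)
qed

theorem theorem1p18:
  "(\<forall>(r::nat) (n::nat) (m::nat) P.
      r \<ge> 1 \<longrightarrow> n \<ge> 1 \<longrightarrow> m \<ge> 1 \<longrightarrow> r_pattern r P \<longrightarrow> r_partite r P \<longrightarrow>
        int (ex_less r n (clique_graph r P m))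
          \<ge> int (n choose r) - int (nat (int n - int r * (int m - 1)) choose r)) \<and>
   (\<exists>C::real. \<forall>r::nat. r \<ge> 1 \<longrightarrow>
      (\<exists>N::nat. \<forall>(n::nat) (m::nat) P.
        n \<ge> 1 \<longrightarrow> n \<ge> N \<longrightarrow> m \<ge> 1 \<longrightarrow> r_pattern r P \<longrightarrow> r_partite r P \<longrightarrow>
          real (ex_less r n (clique_graph r P m))
            \<le> C * (real r ^ 2 * (real m - 1) * real (n choose (r - 1))))) \<and>
   (\<forall>(r::nat) (n::nat) (m::nat).
      r \<ge> 1 \<longrightarrow> n \<ge> 1 \<longrightarrow> m \<ge> 1 \<longrightarrow>
        int (ex_less r n (clique_graph r (alternating_pattern r) m))
          = int (n choose r) - int (nat (int n - int r * (int m - 1)) choose r))"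
proof (intro conjI allI impI)
  have shrink: "nat (int n - int r * (int m - 1)) = n - r * (m - 1)" if "m \<ge> 1" for n r m :: nat
  proof -
    have "int n - int r * (int m - 1) = int n - int (r * (m - 1))" using that by simp
    then show ?thesis by (simp only: nat_diff_distrib' nat_int of_nat_0_le_iff)
  qed
  have lower: "int (ex_less r n (standard_clique r s m))
      \<ge> int (n choose r) - int (nat (int n - int r * (int m - 1)) choose r)"
    if "r \<ge> 1" "s 0" "m \<ge> 1" for r n m :: nat and s
    using ex_less_standard_lower_bound[where s = s and n = n, OF that] shrink[OF that(3), of n r] by simp
  {
    fix r n m :: nat and P
    assume a: "r \<ge> 1" "n \<ge> 1" "m \<ge> 1" "r_pattern r P" "r_partite r P"
    obtain s where s: "s 0" "P = standard_clique r s 2"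
      by (rule r_partite_pattern_standard[OF a(4,5,1)])
    show "int (ex_less r n (clique_graph r P m))
        \<ge> int (n choose r) - int (nat (int n - int r * (int m - 1)) choose r)"
      using lower[where s = s, OF a(1) s(1) a(3)] clique_graph_standard[where s = s, OF a(1) s(1)] s(2) by simp
  next
    have "real (ex_less r n (clique_graph r P m)) \<le> 918 * (real r ^ 2 * (real m - 1) * real (n choose (r - 1)))"
      if a: "r \<ge> 1" "8 * r \<le> n" "m \<ge> 1" "r_pattern r P" "r_partite r P" for r n m P
    proof -
      obtain s where s: "s 0" "P = standard_clique r s 2"
        by (rule r_partite_pattern_standard[OF a(4,5,1)])
      show ?thesis
        using ex_less_standard_upper_bound[where s = s, OF a(1) s(1) a(3,2)]
          clique_graph_standard[where s = s, OF a(1) s(1)] s(2) by simp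
    qed
    then show "\<exists>C::real. \<forall>r::nat. r \<ge> 1 \<longrightarrow>
      (\<exists>N::nat. \<forall>(n::nat) (m::nat) P.
        n \<ge> 1 \<longrightarrow> n \<ge> N \<longrightarrow> m \<ge> 1 \<longrightarrow> r_pattern r P \<longrightarrow> r_partite r P \<longrightarrow>
          real (ex_less r n (clique_graph r P m))
            \<le> C * (real r ^ 2 * (real m - 1) * real (n choose (r - 1))))" by blast
  next
    fix r n m :: nat
    assume a: "r \<ge> 1" "n \<ge> 1" "m \<ge> 1"
    have eq: "clique_graph r (alternating_pattern r) m = standard_clique r even m"
      using clique_graph_standard[where s = even, OF a(1)] alternating_pattern_standard by simp
    have le: "(n - r * (m - 1)) choose r \<le> n choose r" by (rule binomial_right_mono) simp
    have "ex_less r n (standard_clique r even m) \<le> (n choose r) - ((n - r * (m - 1)) choose r)"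
    proof (rule ex_less_standard_le)
      fix F :: "nat set set"
      assume "F \<subseteq> {e. e \<subseteq> {1..n} \<and> card e = r}" "clique_free r even m F"
      from alternating_clique_free_le[OF this a(3,1)]
      show "card F \<le> (n choose r) - ((n - r * (m - 1)) choose r)" by linarith
    qed (use a in auto)
    then show "int (ex_less r n (clique_graph r (alternating_pattern r) m))
        = int (n choose r) - int (nat (int n - int r * (int m - 1)) choose r)"
      using lower[of r even m n] a le unfolding eq shrink[OF a(3)] by simp
  }
qed

end
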